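(* Let $\Delta\subset\mathfrak{t}^*$ be the root system of a complex semisimple Lie algebra with positive roots $\Delta^+$, simple roots $\Delta_0$ and Weyl group $W$, and let $\Sigma_1\subsetneq\Sigma_2\subsetneq\Delta_0$, $W_1=W(\Sigma_1)$, $W_2=W(\Sigma_2)$. Then the projection $\pi\colon W/W_1\to W/W_2$, $\pi(wW_1)=wW_2$, is a GKM fiber bundle from the GKM graph $W/W_1$ to the GKM graph $W/W_2$, with typical fiber $W_2/W_1$; that is, it is a GKM fiber bundle and every fiber $\pi^{-1}(p)$ is isomorphic as a GKM graph to $W_2/W_1$.
   Context: Root data: for $\Sigma\subset\Delta_0$, $\langle\Sigma\rangle\subset\Delta^+$ is the set of positive roots that are linear combinations of roots in $\Sigma$, and $W(\Sigma)$ is the subgroup of $W$ generated by the reflections $s_\alpha$, $\alpha\in\Sigma$; $s_\beta$ denotes the reflection of a root $\beta$. GKM graph of $A/C$: for $\Sigma\subset\Sigma'\subset\Delta_0$, $A=W(\Sigma')$, $C=W(\Sigma)$, the GKM graph $A/C$ has vertices the cosets $[w]=wC$, $w\in A$; $[w]$ and $[v]$ are joined by an edge iff $[v]=[ws_\beta]$ for some $\beta\in\langle\Sigma'\rangle\setminus\langle\Sigma\rangle$ (with $\langle\Delta_0\rangle=\Delta^+$); the oriented edge $([w],[ws_\beta])$ has axial label $w\beta\in\mathfrak{t}^*$ (independent of the representative); the connection along $([w],[ws_\beta])$ sends $([w],[ws_{\beta'}])$ to $([ws_\beta],[ws_\beta s_{\beta'}])$. GKM notions: a GKM graph is a regular graph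 with oriented edges (each edge in both orientations) with a connection $\nabla$ (bijections $\nabla_{(p,q)}\colon E_p\to E_q$, $\nabla_{(p,q)}(p,q)=(q,p)$, $\nabla_{(q,p)}=\nabla_{(p,q)}^{-1}$) and an axial function $\alpha\colon E\to\mathfrak{t}^*$ with $\alpha(q,p)=-\alpha(p,q)$, labels at each vertex pairwise linearly independent, and $\alpha(\nabla_e e')-\alpha(e')\in\mathbb{R}\alpha(e)$. An isomorphism of GKM graphs $(\Gamma_1,\alpha_1)\to(\Gamma_2,\alpha_2)$ (axial functions valued in $\mathfrak{t}_1^*,\mathfrak{t}_2^*$) is a pair $(\Phi,\Psi)$ with $\Phi$ a graph isomorphism and $\Psi\colon\mathfrak{t}_1^*\to\mathfrak{t}_2^*$ a linear isomorphism with $\alpha_2(\Phi p,\Phi q)=\Psi(\alpha_1(p,q))$. A morphism $\pi\colon\Gamma\to B$ maps vertices so each edge is vertical ($\pi p=\pi q$) or horizontal (maps to an edge); it is a fibration if at each vertex $q$, $(q,q')\mapsto(\pi q,\pi q')$ is a bijection from horizontal edges at $q$ to edges of $B$ at $\pi(q)$ (giving unique lifts). $\Gamma_p$ is the induced subgraph on $\pi^{-1}(p)$ and $\Phi_{p,q}\colon\pi^{-1}(p)\to\pi^{-1}(q)$ sends $p'$ to the endpoint of the lift of $(p,q)$ at $p'$. A GKM fibration: a fibration with $\alpha(\tilde e)=\alpha_B(e)$ for each lift $\tilde e$ of $e$, $\nabla$ preserving horizontal/vertical edges, and $\nabla$ along the lift of $e$ sending the lift of $e'$ to the lift of $(\nabla_B)_e(e')$.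 A GKM fiber bundle: a GKM fibration such that each $\Phi_{p,q}$ is a graph morphism $\Gamma_p\to\Gamma_q$, the connection along each lift $(p_1,q_1)$ of $(p,q)$ maps each edge $(p_1,p_2)$ of $\Gamma_p$ to $(\Phi_{p,q}p_1,\Phi_{p,q}p_2)$, and there is a linear isomorphism $\Psi_{p,q}\colon\mathfrak{v}_p^*\to\mathfrak{v}_q^*$ (spans of the labels of the edges of the fibers) making $(\Phi_{p,q},\Psi_{p,q})$ an isomorphism of GKM graphs $\Gamma_p\to\Gamma_q$. *)

theory Defs
  imports "HOL-Analysis.Analysis" "HOL-Algebra.Bij" "HOL-Algebra.Generated_Groups"
begin

section \<open>Root systems and Weyl groups\<close>

definition root_refl :: "'a::euclidean_space \<Rightarrow> 'a \<Rightarrow> 'a" where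
  "root_refl \<alpha> x = x - (2 * (x \<bullet> \<alpha>) / (\<alpha> \<bullet> \<alpha>)) *\<^sub>R \<alpha>"

text \<open>Reduced crystallographic root systems spanning the ambient space \<open>\<tt>\<^sup>*\<close>: these are precisely the
  root systems of complex semisimple Lie algebras. The inner product plays the role of the
  Weyl-invariant form on \<open>\<tt>\<^sup>*\<close>.\<close>

definition root_system :: "'a::euclidean_space set \<Rightarrow> bool" where
  "root_system \<Delta> \<longleftrightarrow>
     finite \<Delta> \<and> 0 \<notin> \<Delta> \<and> span \<Delta> = UNIV \<and>
     (\<forall>\<alpha>\<in>\<Delta>. \<forall>\<beta>\<in>\<Delta>. root_refl \<alpha> \<beta> \<in> \<Delta>) \<and>
     (\<forall>\<alpha>\<in>\<Delta>. \<forall>\<beta>\<in>\<Delta>. 2 * (\<beta> \<bullet> \<alpha>) / (\<alpha> \<bullet> \<alpha>) \<in> \<int>) \<and>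
     (\<forall>\<alpha>\<in>\<Delta>. \<forall>c. c *\<^sub>R \<alpha> \<in> \<Delta> \<longrightarrow> c = 1 \<or> c = -1)"

definition positive_roots :: "'a::euclidean_space set \<Rightarrow> 'a set \<Rightarrow> 'a set" where
  "positive_roots \<Delta> \<Delta>\<^sub>0 = {\<alpha> \<in> \<Delta>. \<exists>c :: 'a \<Rightarrow> nat. \<alpha> = (\<Sum>\<beta>\<in>\<Delta>\<^sub>0. real (c \<beta>) *\<^sub>R \<beta>)}"

definition simple_roots :: "'a::euclidean_space set \<Rightarrow> 'a set \<Rightarrow> bool" where
  "simple_roots \<Delta> \<Delta>\<^sub>0 \<longleftrightarrow>
     \<Delta>\<^sub>0 \<subseteq> \<Delta> \<and> independent \<Delta>\<^sub>0 \<and>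
     (\<forall>\<alpha>\<in>\<Delta>. \<alpha> \<in> positive_roots \<Delta> \<Delta>\<^sub>0 \<or> - \<alpha> \<in> positive_roots \<Delta> \<Delta>\<^sub>0)"

text \<open>The set \<open>\<langle>\<Sigma>\<rangle>\<close>.\<close>

definition roots_spanned :: "'a::euclidean_space set \<Rightarrow> 'a set \<Rightarrow> 'a set \<Rightarrow> 'a set" where
  "roots_spanned \<Delta> \<Delta>\<^sub>0 \<Sigma> = positive_roots \<Delta> \<Delta>\<^sub>0 \<inter> span \<Sigma>"

text \<open>\<open>refl_group \<Sigma>\<close> is \<open>W(\<Sigma>)\<close>; in particular \<open>refl_group \<Delta>\<close> is the Weyl group of \<open>\<Delta>\<close>.\<close>

definition refl_group :: "'a::euclidean_space set \<Rightarrow> ('a \<Rightarrow> 'a) set" where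
  "refl_group \<Sigma> = generate (BijGroup UNIV) (root_refl ` \<Sigma>)"

definition lcoset :: "('a \<Rightarrow> 'a) \<Rightarrow> ('a \<Rightarrow> 'a) set \<Rightarrow> ('a \<Rightarrow> 'a) set" where
  "lcoset w C = w <#\<^bsub>BijGroup UNIV\<^esub> C"


section \<open>GKM graphs\<close>

text \<open>Graphs are simple, so an oriented edge is a pair of vertices. \<open>conn G e\<close> is the map \<open>\<nabla>\<^sub>e\<close>; its
  values off the edges at the initial vertex of \<open>e\<close>, and those of \<open>axial G\<close> off \<open>edges G\<close>, are
  irrelevant.\<close>

record ('v, 'a) gkm =
  verts :: "'v set"
  edges :: "('v \<times> 'v) set"
  conn :: "'v \<times> 'v \<Rightarrow> 'v \<times> 'v \<Rightarrow> 'v \<times> 'v"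
  axial :: "'v \<times> 'v \<Rightarrow> 'a"

definition edges_at :: "('v, 'a) gkm \<Rightarrow> 'v \<Rightarrow> ('v \<times> 'v) set" where
  "edges_at G p = {e \<in> edges G. fst e = p}"

definition regular_graph :: "('v, 'a) gkm \<Rightarrow> bool" where
  "regular_graph G \<longleftrightarrow>
     edges G \<subseteq> verts G \<times> verts G \<and> irrefl (edges G) \<and> sym (edges G) \<and>
     (\<exists>d. \<forall>p\<in>verts G. finite (edges_at G p) \<and> card (edges_at G p) = d)"

definition is_connection :: "('v, 'a) gkm \<Rightarrow> bool" where
  "is_connection G \<longleftrightarrow>
     (\<forall>(p, q)\<in>edges G.
        bij_betw (conn G (p, q)) (edges_at G p) (edges_at G q) \<and>
        conn G (p, q) (p, q) = (q, p) \<and>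
        (\<forall>e\<in>edges_at G p. conn G (q, p) (conn G (p, q) e) = e))"

definition is_axial :: "('v, 'a::euclidean_space) gkm \<Rightarrow> bool" where
  "is_axial G \<longleftrightarrow>
     (\<forall>(p, q)\<in>edges G. axial G (q, p) = - axial G (p, q)) \<and>
     (\<forall>p\<in>verts G. \<forall>e\<in>edges_at G p. \<forall>e'\<in>edges_at G p. e \<noteq> e' \<longrightarrow>
        axial G e \<noteq> axial G e' \<and> independent {axial G e, axial G e'}) \<and>
     (\<forall>e\<in>edges G. \<forall>e'\<in>edges_at G (fst e).
        \<exists>c. axial G (conn G e e') - axial G e' = c *\<^sub>R axial G e)"

definition gkm_graph :: "('v, 'a::euclidean_space) gkm \<Rightarrow> bool" where
  "gkm_graph G \<longleftrightarrow> regular_graph G \<and> is_connection G \<and> is_axial G"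

definition graph_iso :: "('v, 'a) gkm \<Rightarrow> ('w, 'b) gkm \<Rightarrow> ('v \<Rightarrow> 'w) \<Rightarrow> bool" where
  "graph_iso G H \<Phi> \<longleftrightarrow>
     bij_betw \<Phi> (verts G) (verts H) \<and>
     (\<forall>p\<in>verts G. \<forall>q\<in>verts G. (p, q) \<in> edges G \<longleftrightarrow> (\<Phi> p, \<Phi> q) \<in> edges H)"

text \<open>The span of all labels. The subspaces \<open>\<vv>\<^sub>p\<^sup>*\<close> are the label spans of the fibers.\<close>

definition label_span :: "('v, 'a::euclidean_space) gkm \<Rightarrow> 'a set" where
  "label_span G = span (axial G ` edges G)"

text \<open>Isomorphisms of GKM graphs, the axial functions being regarded as valued in the label spans.
  A linear isomorphism of subspaces is given as the restriction of a linear map on the ambient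
  space, which need not be bijective there.\<close>

definition gkm_iso ::
  "('v, 'a::euclidean_space) gkm \<Rightarrow> ('w, 'b::euclidean_space) gkm \<Rightarrow> ('v \<Rightarrow> 'w) \<Rightarrow> ('a \<Rightarrow> 'b) \<Rightarrow> bool"
where
  "gkm_iso G H \<Phi> \<Psi> \<longleftrightarrow>
     gkm_graph G \<and> gkm_graph H \<and> graph_iso G H \<Phi> \<and>
     linear \<Psi> \<and> bij_betw \<Psi> (label_span G) (label_span H) \<and>
     (\<forall>(p, q)\<in>edges G. axial H (\<Phi> p, \<Phi> q) = \<Psi> (axial G (p, q)))"

definition gkm_isomorphic ::
  "('v, 'a::euclidean_space) gkm \<Rightarrow> ('w, 'b::euclidean_space) gkm \<Rightarrow> bool" where
  "gkm_isomorphic G H \<longleftrightarrow> (\<exists>\<Phi> \<Psi>. gkm_iso G H \<Phi> \<Psi>)"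


section \<open>GKM fibrations and fiber bundles\<close>

definition graph_morphism :: "('v, 'a) gkm \<Rightarrow> ('w, 'b) gkm \<Rightarrow> ('v \<Rightarrow> 'w) \<Rightarrow> bool" where
  "graph_morphism G B \<pi> \<longleftrightarrow>
     \<pi> ` verts G \<subseteq> verts B \<and>
     (\<forall>(p, q)\<in>edges G. \<pi> p = \<pi> q \<or> (\<pi> p, \<pi> q) \<in> edges B)"

definition vertical :: "('v \<Rightarrow> 'w) \<Rightarrow> 'v \<times> 'v \<Rightarrow> bool" where
  "vertical \<pi> e \<longleftrightarrow> \<pi> (fst e) = \<pi> (snd e)"

definition horizontal :: "('w, 'b) gkm \<Rightarrow> ('v \<Rightarrow> 'w) \<Rightarrow> 'v \<times> 'v \<Rightarrow> bool" where
  "horizontal B \<pi> e \<longleftrightarrow> map_prod \<pi> \<pi> e \<in> edges B"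

definition horizontal_at ::
  "('v, 'a) gkm \<Rightarrow> ('w, 'b) gkm \<Rightarrow> ('v \<Rightarrow> 'w) \<Rightarrow> 'v \<Rightarrow> ('v \<times> 'v) set" where
  "horizontal_at G B \<pi> q = {e \<in> edges_at G q. horizontal B \<pi> e}"

definition graph_fibration :: "('v, 'a) gkm \<Rightarrow> ('w, 'b) gkm \<Rightarrow> ('v \<Rightarrow> 'w) \<Rightarrow> bool" where
  "graph_fibration G B \<pi> \<longleftrightarrow>
     graph_morphism G B \<pi> \<and>
     (\<forall>q\<in>verts G. bij_betw (map_prod \<pi> \<pi>) (horizontal_at G B \<pi> q) (edges_at B (\<pi> q)))"

text \<open>The lift of the edge \<open>e\<close> of the base at the vertex \<open>p'\<close>, where \<open>\<pi> p' = fst e\<close>.\<close>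

definition lift ::
  "('v, 'a) gkm \<Rightarrow> ('w, 'b) gkm \<Rightarrow> ('v \<Rightarrow> 'w) \<Rightarrow> 'w \<times> 'w \<Rightarrow> 'v \<Rightarrow> 'v \<times> 'v" where
  "lift G B \<pi> e p' = (THE e'. e' \<in> horizontal_at G B \<pi> p' \<and> map_prod \<pi> \<pi> e' = e)"

text \<open>The induced subgraph \<open>\<Gamma>\<^sub>p\<close> on \<open>\<pi>\<^sup>-\<^sup>1(p)\<close>, and the map \<open>\<Phi>\<^sub>p\<^sub>,\<^sub>q\<close> between fibers.\<close>

definition fiber :: "('v, 'a) gkm \<Rightarrow> ('v \<Rightarrow> 'w) \<Rightarrow> 'w \<Rightarrow> ('v, 'a) gkm" where
  "fiber G \<pi> p =
     \<lparr> verts = {v \<in> verts G. \<pi> v = p},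
       edges = {(v, v') \<in> edges G. \<pi> v = p \<and> \<pi> v' = p},
       conn = conn G,
       axial = axial G \<rparr>"

definition transport ::
  "('v, 'a) gkm \<Rightarrow> ('w, 'b) gkm \<Rightarrow> ('v \<Rightarrow> 'w) \<Rightarrow> 'w \<Rightarrow> 'w \<Rightarrow> 'v \<Rightarrow> 'v" where
  "transport G B \<pi> p q p' = snd (lift G B \<pi> (p, q) p')"

definition gkm_fibration ::
  "('v, 'a::euclidean_space) gkm \<Rightarrow> ('w, 'a) gkm \<Rightarrow> ('v \<Rightarrow> 'w) \<Rightarrow> bool" where
  "gkm_fibration G B \<pi> \<longleftrightarrow>
     gkm_graph G \<and> gkm_graph B \<and> graph_fibration G B \<pi> \<and>
     (\<forall>p'\<in>verts G. \<forall>e\<in>edges_at B (\<pi> p'). axial G (lift G B \<pi> e p') = axial B e) \<and>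
     (\<forall>e\<in>edges G. \<forall>e'\<in>edges_at G (fst e).
        (horizontal B \<pi> e' \<longrightarrow> horizontal B \<pi> (conn G e e')) \<and>
        (vertical \<pi> e' \<longrightarrow> vertical \<pi> (conn G e e'))) \<and>
     (\<forall>p'\<in>verts G. \<forall>e\<in>edges_at B (\<pi> p'). \<forall>e'\<in>edges_at B (\<pi> p').
        conn G (lift G B \<pi> e p') (lift G B \<pi> e' p') =
        lift G B \<pi> (conn B e e') (snd (lift G B \<pi> e p')))"

definition gkm_fiber_bundle ::
  "('v, 'a::euclidean_space) gkm \<Rightarrow> ('w, 'a) gkm \<Rightarrow> ('v \<Rightarrow> 'w) \<Rightarrow> bool" where
  "gkm_fiber_bundle G B \<pi> \<longleftrightarrow>
     gkm_fibration G B \<pi> \<and>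
     (\<forall>(p, q)\<in>edges B.
        graph_morphism (fiber G \<pi> p) (fiber G \<pi> q) (transport G B \<pi> p q) \<and>
        (\<forall>(p\<^sub>1, p\<^sub>2)\<in>edges (fiber G \<pi> p).
           conn G (lift G B \<pi> (p, q) p\<^sub>1) (p\<^sub>1, p\<^sub>2) =
           (transport G B \<pi> p q p\<^sub>1, transport G B \<pi> p q p\<^sub>2)) \<and>
        (\<exists>\<Psi>. gkm_iso (fiber G \<pi> p) (fiber G \<pi> q) (transport G B \<pi> p q) \<Psi>))"


section \<open>GKM graphs of quotients of Weyl groups\<close>

text \<open>The GKM graph \<open>A/C\<close> for groups \<open>C \<subseteq> A\<close> of linear maps generated by reflections, with edges
  \<open>([w],[w s\<^sub>\<beta>])\<close> for \<open>\<beta> \<in> R\<close>. The descriptions \<open>THE\<close> express that the axial label and the connection do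
  not depend on the choice of representatives.\<close>

definition quotient_gkm ::
  "('a::euclidean_space \<Rightarrow> 'a) set \<Rightarrow> ('a \<Rightarrow> 'a) set \<Rightarrow> 'a set \<Rightarrow> (('a \<Rightarrow> 'a) set, 'a) gkm" where
  "quotient_gkm A C R =
     \<lparr> verts = {lcoset w C | w. w \<in> A},
       edges = {(lcoset w C, lcoset (w \<circ> root_refl \<beta>) C) | w \<beta>. w \<in> A \<and> \<beta> \<in> R},
       conn = (\<lambda>e e'. THE e''. \<exists>w\<in>A. \<exists>\<beta>\<in>R. \<exists>\<beta>'\<in>R.
         e = (lcoset w C, lcoset (w \<circ> root_refl \<beta>) C) \<and>
         e' = (lcoset w C, lcoset (w \<circ> root_refl \<beta>') C) \<and>
         e'' = (lcoset (w \<circ> root_refl \<beta>) C, lcoset (w \<circ> root_refl \<beta> \<circ> root_refl \<beta>') C)),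
       axial = (\<lambda>e. THE l. \<exists>w\<in>A. \<exists>\<beta>\<in>R.
         e = (lcoset w C, lcoset (w \<circ> root_refl \<beta>) C) \<and> l = w \<beta>) \<rparr>"

text \<open>The map \<open>w C \<mapsto> w D\<close> on cosets of elements of \<open>A\<close>.\<close>

definition coset_proj ::
  "('a \<Rightarrow> 'a) set \<Rightarrow> ('a \<Rightarrow> 'a) set \<Rightarrow> ('a \<Rightarrow> 'a) set \<Rightarrow> ('a \<Rightarrow> 'a) set \<Rightarrow> ('a \<Rightarrow> 'a) set" where
  "coset_proj A C D P = (THE Q. \<exists>w\<in>A. P = lcoset w C \<and> Q = lcoset w D)"

end

theory Submission
  imports Defs
begin

text \<open>
  An element of \<open>W(\<Sigma>)\<close> fixes the orthogonal complement of \<open>\<Sigma>\<close> pointwise. Hence, for positive roots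
  \<open>\<beta>, \<gamma>\<close> outside \<open>\<langle>\<Sigma>\<rangle>\<close>, neither \<open>s\<^sub>\<beta>\<close> nor, if \<open>\<beta> \<noteq> \<gamma>\<close>, the product \<open>s\<^sub>\<beta> s\<^sub>\<gamma>\<close> lies in \<open>W(\<Sigma>)\<close>: a
  vector of that complement which is not orthogonal to \<open>\<beta>\<close> would be fixed by \<open>s\<^sub>\<beta>\<close>, or else have the
  same image under \<open>s\<^sub>\<beta>\<close> and \<open>s\<^sub>\<gamma>\<close>, which makes \<open>\<beta>\<close> and \<open>\<gamma>\<close> parallel. Together with the
  facts that \<open>W(\<Sigma>)\<close> permutes the positive roots outside \<open>\<langle>\<Sigma>\<rangle>\<close> and contains \<open>s\<^sub>\<beta>\<close> for
  \<open>\<beta> \<in> \<langle>\<Sigma>\<rangle>\<close>, this makes the edges at \<open>[w]\<close> correspond bijectively to those positive roots, and an edge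
  of \<open>W/W\<^sub>1\<close> is horizontal exactly if its root lies outside \<open>\<langle>\<Sigma>\<^sub>2\<rangle>\<close>. The fiber over \<open>w W\<^sub>2\<close> consists of
  the cosets of \<open>W\<^sub>1\<close> in \<open>w W\<^sub>2\<close>; both the identification with \<open>W\<^sub>2/W\<^sub>1\<close> and the transport between
  fibers are left multiplications by isometries, which also relate the labels.
\<close>

section \<open>Reflections and reflection groups\<close>

lemma root_refl_involution [simp]: "root_refl \<alpha> (root_refl \<alpha> x) = x"
  by (cases "\<alpha> = 0") (simp_all add: root_refl_def algebra_simps)

lemma root_refl_comp_self: "root_refl \<alpha> \<circ> root_refl \<alpha> = id"
  by (simp add: fun_eq_iff)

lemma root_refl_comp_self': "f \<circ> root_refl \<alpha> \<circ> root_refl \<alpha> = f"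
  by (simp add: fun_eq_iff)

lemma root_refl_self: "root_refl \<alpha> \<alpha> = - \<alpha>"
  by (cases "\<alpha> = 0") (simp_all add: root_refl_def algebra_simps scaleR_2)

lemma orthogonal_transformation_root_refl: "orthogonal_transformation (root_refl \<alpha>)"
proof -
  have "linear (root_refl \<alpha>)"
    by (rule linearI)
      (simp_all add: root_refl_def inner_add_left algebra_simps add_divide_distrib)
  moreover have "root_refl \<alpha> v \<bullet> root_refl \<alpha> w = v \<bullet> w" for v w
    by (cases "\<alpha> = 0") (simp_all add: root_refl_def inner_diff_left inner_diff_right inner_commute)
  ultimately show ?thesis
    by (simp add: orthogonal_transformation_def)
qed

text \<open>Isometries preserve the inner products in the reflection formula. This rule is what
  moves a reflection past a group element in every later change of representative.\<close>

lemma orthogonal_transformation_root_refl_conj: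
  assumes "orthogonal_transformation f"
  shows "f \<circ> root_refl \<alpha> = root_refl (f \<alpha>) \<circ> f"
  using assms
  by (auto simp: fun_eq_iff orthogonal_transformation_def root_refl_def linear_diff linear_scale)

section \<open>Reflection groups inside the group of bijections\<close>

lemma bij_root_refl: "bij (root_refl \<alpha>)"
  by (rule o_bij[of "root_refl \<alpha>"]) (rule root_refl_comp_self)+

text \<open>The product of \<open>BijGroup\<close> is composition only on bijections, which is why
  bijectivity has to be carried along.\<close>

lemma mult_BijGroup_UNIV:
  assumes "bij f" "bij g"
  shows "f \<otimes>\<^bsub>BijGroup UNIV\<^esub> g = f \<circ> g"
  using assms by (auto simp: BijGroup_def Bij_def fun_eq_iff compose_def)

lemma lcoset_eq:
  assumes "bij w" "\<And>c. c \<in> C \<Longrightarrow> bij c"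
  shows "lcoset w C = (\<circ>) w ` C"
  using assms by (auto simp: lcoset_def l_coset_def mult_BijGroup_UNIV)

lemma
  shows id_in_refl_group: "id \<in> refl_group \<Sigma>"
    and root_refl_in_refl_group: "\<alpha> \<in> \<Sigma> \<Longrightarrow> root_refl \<alpha> \<in> refl_group \<Sigma>"
proof -
  have "\<one>\<^bsub>BijGroup UNIV\<^esub> = (id :: 'a \<Rightarrow> 'a)"
    by (auto simp: BijGroup_def fun_eq_iff)
  then show "id \<in> refl_group \<Sigma>"
    unfolding refl_group_def by (metis generate.one)
  show "\<alpha> \<in> \<Sigma> \<Longrightarrow> root_refl \<alpha> \<in> refl_group \<Sigma>"
    unfolding refl_group_def by (intro generate.incl) auto
qed

lemma inv_BijGroup_root_refl: "inv\<^bsub>BijGroup UNIV\<^esub> (root_refl \<alpha>) = root_refl \<alpha>"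
proof -
  interpret group "BijGroup (UNIV :: 'a set)" by (rule group_BijGroup)
  have "root_refl \<alpha> \<in> carrier (BijGroup UNIV)"
    by (simp add: BijGroup_def Bij_def bij_root_refl)
  moreover have "root_refl \<alpha> \<otimes>\<^bsub>BijGroup UNIV\<^esub> root_refl \<alpha> = \<one>\<^bsub>BijGroup UNIV\<^esub>"
    by (subst mult_BijGroup_UNIV[OF bij_root_refl bij_root_refl]) (auto simp: BijGroup_def fun_eq_iff)
  ultimately show ?thesis
    by (simp add: inv_equality)
qed

lemma refl_group_bij:
  assumes "w \<in> refl_group \<Sigma>"
  shows "bij w"
proof -
  interpret group "BijGroup (UNIV :: 'a set)" by (rule group_BijGroup)
  have "refl_group \<Sigma> \<subseteq> carrier (BijGroup UNIV)"
    unfolding refl_group_def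
    by (intro generate_incl) (auto simp: BijGroup_def Bij_def bij_root_refl)
  then show ?thesis
    using assms by (auto simp: BijGroup_def Bij_def)
qed

lemma comp_in_refl_group:
  assumes "v \<in> refl_group \<Sigma>" "w \<in> refl_group \<Sigma>"
  shows "v \<circ> w \<in> refl_group \<Sigma>"
  using generate.eng[of v "BijGroup UNIV" "root_refl ` \<Sigma>" w] assms
    mult_BijGroup_UNIV[OF refl_group_bij[OF assms(1)] refl_group_bij[OF assms(2)]]
  by (simp add: refl_group_def)

text \<open>Reflections are their own inverses, so the inverse case of \<open>generate\<close>
  merges with the case of generators.\<close>

lemma refl_group_induct [consumes 1, case_names id refl comp]:
  assumes "w \<in> refl_group \<Sigma>"
    and id: "P id"
    and refl: "\<And>\<alpha>. \<alpha> \<in> \<Sigma> \<Longrightarrow> P (root_refl \<alpha>)"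
    and comp: "\<And>v w. v \<in> refl_group \<Sigma> \<Longrightarrow> w \<in> refl_group \<Sigma> \<Longrightarrow> P v \<Longrightarrow> P w \<Longrightarrow> P (v \<circ> w)"
  shows "P w"
  using assms(1) unfolding refl_group_def
proof (induction rule: generate.induct)
  case one
  have "\<one>\<^bsub>BijGroup UNIV\<^esub> = (id :: 'a \<Rightarrow> 'a)"
    by (auto simp: BijGroup_def fun_eq_iff)
  then show ?case using id by metis
next
  case (incl h)
  then show ?case using refl by auto
next
  case (inv h)
  then show ?case using refl by (auto simp: inv_BijGroup_root_refl)
next
  case (eng h1 h2)
  then have "h1 \<in> refl_group \<Sigma>" "h2 \<in> refl_group \<Sigma>"
    by (simp_all add: refl_group_def)
  moreover from this have "h1 \<otimes>\<^bsub>BijGroup UNIV\<^esub> h2 = h1 \<circ> h2"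
    by (intro mult_BijGroup_UNIV refl_group_bij)
  ultimately show ?case
    using eng.IH comp by metis
qed

lemma refl_group_orthogonal: "w \<in> refl_group \<Sigma> \<Longrightarrow> orthogonal_transformation w"
  by (induction rule: refl_group_induct)
    (blast intro: orthogonal_transformation_root_refl orthogonal_transformation_compose
      orthogonal_transformation_id[folded id_def])+

lemma refl_group_inverse:
  assumes "w \<in> refl_group \<Sigma>"
  shows "\<exists>v\<in>refl_group \<Sigma>. w \<circ> v = id"
  using assms
proof (induction rule: refl_group_induct)
  case id
  show ?case using id_in_refl_group by (intro bexI[of _ id]) simp_all
next
  case (refl \<alpha>)
  then show ?case using root_refl_in_refl_group root_refl_comp_self by blast
next
  case (comp v w)
  then obtain v' w' where "v' \<in> refl_group \<Sigma>" "w' \<in> refl_group \<Sigma>" "v \<circ> v' = id" "w \<circ> w' = id"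
    by blast
  then have "w' \<circ> v' \<in> refl_group \<Sigma>" "v \<circ> w \<circ> (w' \<circ> v') = id"
    using comp_in_refl_group by (auto simp: fun_eq_iff)
  then show ?case by blast
qed

lemma refl_group_mono: "\<Sigma> \<subseteq> \<Sigma>' \<Longrightarrow> refl_group \<Sigma> \<subseteq> refl_group \<Sigma>'"
proof
  fix w assume "w \<in> refl_group \<Sigma>" "\<Sigma> \<subseteq> \<Sigma>'"
  then show "w \<in> refl_group \<Sigma>'"
    by (induction rule: refl_group_induct)
      (auto intro: id_in_refl_group root_refl_in_refl_group comp_in_refl_group)
qed

lemma refl_group_fixes_orthogonal:
  assumes "w \<in> refl_group \<Sigma>" "\<And>\<alpha>. \<alpha> \<in> \<Sigma> \<Longrightarrow> x \<bullet> \<alpha> = 0"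
  shows "w x = x"
  using assms by (induction rule: refl_group_induct) (simp_all add: root_refl_def)

text \<open>The vector is the component \<open>z\<close> of \<beta> orthogonal to the span of
  \<Sigma>: it is nonzero, and its inner product with \<beta> equals
  \<open>z \<bullet> z\<close>.\<close>

lemma exists_refl_group_fixed:
  assumes "\<beta> \<notin> span \<Sigma>"
  shows "\<exists>x. x \<bullet> \<beta> \<noteq> 0 \<and> (\<forall>w\<in>refl_group \<Sigma>. w x = x)"
proof -
  obtain y z where yz: "y \<in> span \<Sigma>" "\<And>w. w \<in> span \<Sigma> \<Longrightarrow> orthogonal z w" "\<beta> = y + z"
    using orthogonal_subspace_decomp_exists[of \<Sigma> \<beta>] by metis
  have "z \<noteq> 0" using yz assms by auto
  moreover have "z \<bullet> y = 0" using yz by (auto simp: orthogonal_def)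
  ultimately have "z \<bullet> \<beta> \<noteq> 0" using yz(3) by (simp add: inner_add_right)
  moreover have "z \<bullet> \<alpha> = 0" if "\<alpha> \<in> \<Sigma>" for \<alpha>
    using yz(2)[OF span_base[OF that]] by (simp add: orthogonal_def)
  ultimately show ?thesis
    using refl_group_fixes_orthogonal by metis
qed


section \<open>Root systems with a base\<close>

locale based_root_system =
  fixes \<Delta> \<Delta>\<^sub>0 :: "'a::euclidean_space set"
  assumes roots: "root_system \<Delta>" and simple: "simple_roots \<Delta> \<Delta>\<^sub>0"
begin

abbreviation "pos \<equiv> positive_roots \<Delta> \<Delta>\<^sub>0"

lemma finite_roots: "finite \<Delta>" and root_nonzero: "0 \<notin> \<Delta>" and span_roots: "span \<Delta> = UNIV"
  and refl_root: "\<alpha> \<in> \<Delta> \<Longrightarrow> \<beta> \<in> \<Delta> \<Longrightarrow> root_refl \<alpha> \<beta> \<in> \<Delta>"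
  and root_multiple: "\<alpha> \<in> \<Delta> \<Longrightarrow> c *\<^sub>R \<alpha> \<in> \<Delta> \<Longrightarrow> c = 1 \<or> c = -1"
  using roots by (auto simp: root_system_def)

lemma simple_root: "\<alpha> \<in> \<Delta>\<^sub>0 \<Longrightarrow> \<alpha> \<in> \<Delta>" and independent_simple: "independent \<Delta>\<^sub>0"
  and pos_or_neg: "\<alpha> \<in> \<Delta> \<Longrightarrow> \<alpha> \<in> pos \<or> - \<alpha> \<in> pos"
  using simple by (auto simp: simple_roots_def)

section \<open>Coordinates relative to the simple roots, and positivity\<close>

lemma finite_simple: "finite \<Delta>\<^sub>0"
  by (rule finite_subset[OF _ finite_roots]) (auto simp: simple_root)

lemma pos_root: "\<beta> \<in> pos \<Longrightarrow> \<beta> \<in> \<Delta>"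
  by (simp add: positive_roots_def)

text \<open>A dual basis vector, extended linearly from the independent set
  \<open>\<Delta>\<^sub>0\<close>; it allows coefficients of roots to be compared one at a
  time.\<close>

lemma coordinate_functional:
  assumes "\<gamma> \<in> \<Delta>\<^sub>0"
  shows "\<exists>f :: 'a \<Rightarrow> real. linear f \<and> (\<forall>\<delta>\<in>\<Delta>\<^sub>0. \<delta> \<noteq> \<gamma> \<longrightarrow> f \<delta> = 0) \<and>
    (\<forall>c. f (\<Sum>\<delta>\<in>\<Delta>\<^sub>0. c \<delta> *\<^sub>R \<delta>) = c \<gamma>)"
proof -
  obtain f where f: "linear f" "\<forall>\<delta>\<in>\<Delta>\<^sub>0. f \<delta> = (if \<delta> = \<gamma> then 1 else 0 :: real)"
    using linear_independent_extend[OF independent_simple, of "\<lambda>\<delta>. if \<delta> = \<gamma> then 1 else 0 :: real"]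
    by blast
  have "f (\<Sum>\<delta>\<in>\<Delta>\<^sub>0. c \<delta> *\<^sub>R \<delta>) = c \<gamma>" for c
  proof -
    have "f (\<Sum>\<delta>\<in>\<Delta>\<^sub>0. c \<delta> *\<^sub>R \<delta>) = (\<Sum>\<delta>\<in>\<Delta>\<^sub>0. c \<delta> * f \<delta>)"
      using f(1) by (simp add: linear_sum linear_scale)
    also have "\<dots> = (\<Sum>\<delta>\<in>\<Delta>\<^sub>0. if \<delta> = \<gamma> then c \<delta> else 0)"
      using f(2) by (intro sum.cong) auto
    finally show ?thesis
      using assms finite_simple by simp
  qed
  with f show ?thesis by (intro exI[of _ f]) simp
qed

lemma pos_coordinates:
  assumes "\<beta> \<in> pos"
  obtains c :: "'a \<Rightarrow> nat" where "\<beta> = (\<Sum>\<delta>\<in>\<Delta>\<^sub>0. real (c \<delta>) *\<^sub>R \<delta>)"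
  using assms by (auto simp: positive_roots_def)

text \<open>A simple reflection changes only the \<gamma>-coordinate. If the image of \<beta> were
  negative, all other coordinates of \<beta> would vanish, and reducedness would force \<beta> to be
  \<gamma>.\<close>

lemma simple_refl_pos:
  assumes "\<gamma> \<in> \<Delta>\<^sub>0" "\<beta> \<in> pos" "\<beta> \<noteq> \<gamma>"
  shows "root_refl \<gamma> \<beta> \<in> pos"
proof (rule ccontr)
  assume "root_refl \<gamma> \<beta> \<notin> pos"
  then have "- root_refl \<gamma> \<beta> \<in> pos"
    using pos_or_neg refl_root simple_root pos_root assms by blast
  then obtain d :: "'a \<Rightarrow> nat" where d: "- root_refl \<gamma> \<beta> = (\<Sum>\<delta>\<in>\<Delta>\<^sub>0. real (d \<delta>) *\<^sub>R \<delta>)"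
    by (rule pos_coordinates)
  obtain c :: "'a \<Rightarrow> nat" where c: "\<beta> = (\<Sum>\<delta>\<in>\<Delta>\<^sub>0. real (c \<delta>) *\<^sub>R \<delta>)"
    using assms(2) by (rule pos_coordinates)
  have "c \<delta> = 0" if \<delta>: "\<delta> \<in> \<Delta>\<^sub>0" "\<delta> \<noteq> \<gamma>" for \<delta>
  proof -
    obtain f :: "'a \<Rightarrow> real" where lin: "linear f" and zero: "\<forall>\<epsilon>\<in>\<Delta>\<^sub>0. \<epsilon> \<noteq> \<delta> \<longrightarrow> f \<epsilon> = 0"
      and coord: "\<forall>c. f (\<Sum>\<delta>\<in>\<Delta>\<^sub>0. c \<delta> *\<^sub>R \<delta>) = c \<delta>"
      using coordinate_functional[OF \<delta>(1)] by blast
    have f: "linear f" "f \<gamma> = 0" "f \<beta> = c \<delta>" "f (- root_refl \<gamma> \<beta>) = d \<delta>"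
      using lin zero \<delta> assms(1) coord[rule_format, of "\<lambda>\<delta>. real (c \<delta>)"]
        coord[rule_format, of "\<lambda>\<delta>. real (d \<delta>)"]
      by (auto simp flip: c d)
    \<comment> \<open>Since \<open>f \<gamma> = 0\<close>, reflecting does not change
      \<open>f \<beta>\<close>. Hence the natural numbers \<open>c \<delta>\<close> and
      \<open>d \<delta>\<close> are negatives of each other, so both are zero.\<close>
    have "f (- root_refl \<gamma> \<beta>) = - f \<beta>"
      using f(1,2) by (simp add: root_refl_def linear_diff linear_scale linear_neg)
    with f show ?thesis by simp
  qed
  then have "(\<Sum>\<delta>\<in>\<Delta>\<^sub>0. real (c \<delta>) *\<^sub>R \<delta>) = (\<Sum>\<delta>\<in>\<Delta>\<^sub>0. if \<delta> = \<gamma> then real (c \<gamma>) *\<^sub>R \<gamma> else 0)"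
    by (intro sum.cong) auto
  with c have "\<beta> = real (c \<gamma>) *\<^sub>R \<gamma>"
    using assms(1) finite_simple by simp
  moreover from this have "real (c \<gamma>) = 1"
    using root_multiple[of \<gamma> "real (c \<gamma>)"] pos_root[OF assms(2)] simple_root[OF assms(1)] by auto
  ultimately show False using assms(3) by simp
qed

text \<open>Reducedness leaves only the signs plus and minus; minus would make all coordinates of
  \<beta> both nonnegative and nonpositive.\<close>

lemma pos_parallel_eq:
  assumes "\<beta> \<in> pos" "\<gamma> \<in> pos" "\<beta> = t *\<^sub>R \<gamma>"
  shows "\<beta> = \<gamma>"
proof (rule ccontr)
  assume "\<beta> \<noteq> \<gamma>"
  with assms have t: "\<beta> = - \<gamma>"
    using root_multiple[of \<gamma> t] pos_root by auto
  obtain c :: "'a \<Rightarrow> nat" where c: "\<beta> = (\<Sum>\<delta>\<in>\<Delta>\<^sub>0. real (c \<delta>) *\<^sub>R \<delta>)"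
    using assms(1) by (rule pos_coordinates)
  obtain d :: "'a \<Rightarrow> nat" where d: "\<gamma> = (\<Sum>\<delta>\<in>\<Delta>\<^sub>0. real (d \<delta>) *\<^sub>R \<delta>)"
    using assms(2) by (rule pos_coordinates)
  have "c \<delta> = 0" if \<delta>: "\<delta> \<in> \<Delta>\<^sub>0" for \<delta>
  proof -
    obtain f :: "'a \<Rightarrow> real" where f: "linear f"
      and coord: "\<forall>c. f (\<Sum>\<delta>\<in>\<Delta>\<^sub>0. c \<delta> *\<^sub>R \<delta>) = c \<delta>"
      using coordinate_functional[OF \<delta>] by blast
    have coords: "f \<beta> = c \<delta>" "f \<gamma> = d \<delta>"
      using coord[rule_format, of "\<lambda>\<delta>. real (c \<delta>)"] coord[rule_format, of "\<lambda>\<delta>. real (d \<delta>)"]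
      by (simp_all flip: c d)
    have "f \<beta> = - f \<gamma>"
      using f by (simp add: t linear_neg)
    with coords show ?thesis by simp
  qed
  with c have "\<beta> = 0" by simp
  then show False using assms(1) pos_root root_nonzero by metis
qed

lemma span_simple: "span \<Delta>\<^sub>0 = UNIV"
proof -
  have pos: "\<beta> \<in> span \<Delta>\<^sub>0" if "\<beta> \<in> pos" for \<beta>
    using that by (auto simp: positive_roots_def intro!: span_sum span_scale intro: span_base)
  have "\<beta> \<in> span \<Delta>\<^sub>0" if "\<beta> \<in> \<Delta>" for \<beta>
    using pos_or_neg[OF that] pos[of \<beta>] pos[of "- \<beta>"] span_neg[of "-\<beta>" \<Delta>\<^sub>0] by auto
  then have "span \<Delta> \<subseteq> span \<Delta>\<^sub>0"
    by (intro span_minimal) auto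
  then show ?thesis using span_roots by auto
qed

text \<open>Some simple root \<open>\<gamma>\<close> occurring in \<open>\<beta>\<close> has \<open>\<beta> \<bullet> \<gamma> > 0\<close>; reflecting \<open>\<beta>\<close> in it lowers the height.\<close>

lemma refl_in_refl_group:
  assumes "\<Sigma> \<subseteq> \<Delta>\<^sub>0" "\<beta> \<in> roots_spanned \<Delta> \<Delta>\<^sub>0 \<Sigma>"
  shows "root_refl \<beta> \<in> refl_group \<Sigma>"
proof -
  \<comment> \<open>The height: the linear functional equal to 1 on every simple root, hence a
    natural number on positive roots.\<close>
  obtain ht :: "'a \<Rightarrow> real" where ht: "linear ht" "\<And>\<delta>. \<delta> \<in> \<Delta>\<^sub>0 \<Longrightarrow> ht \<delta> = 1"
    using linear_independent_extend[OF independent_simple, of "\<lambda>_. 1 :: real"] by blast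
  have ht_nat: "ht \<beta> \<in> \<nat>" if \<beta>: "\<beta> \<in> pos" for \<beta>
  proof -
    obtain c :: "'a \<Rightarrow> nat" where c: "\<beta> = (\<Sum>\<delta>\<in>\<Delta>\<^sub>0. real (c \<delta>) *\<^sub>R \<delta>)"
      using \<beta> by (rule pos_coordinates)
    show ?thesis
      unfolding c using ht by (simp add: linear_sum linear_scale flip: of_nat_sum)
  qed
  have "root_refl \<beta> \<in> refl_group \<Sigma>" if "\<beta> \<in> pos" "\<beta> \<in> span \<Sigma>" "ht \<beta> = real n" for \<beta> n
    using that
  proof (induction n arbitrary: \<beta> rule: less_induct)
    case (less n)
    obtain c :: "'a \<Rightarrow> nat" where c: "\<beta> = (\<Sum>\<delta>\<in>\<Delta>\<^sub>0. real (c \<delta>) *\<^sub>R \<delta>)"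
      using less.prems(1) by (rule pos_coordinates)
    \<comment> \<open>Expanding one factor over the simple roots writes a positive number as a sum,
      so some summand is positive; its simple root is \<gamma>.\<close>
    have "\<beta> \<bullet> \<beta> = (\<Sum>\<delta>\<in>\<Delta>\<^sub>0. real (c \<delta>) * (\<beta> \<bullet> \<delta>))"
      using arg_cong[OF c, of "\<lambda>x. \<beta> \<bullet> x"] by (simp add: inner_sum_right)
    moreover have "\<beta> \<bullet> \<beta> > 0"
      using pos_root[OF less.prems(1)] root_nonzero by auto
    ultimately have "\<not> (\<forall>\<delta>\<in>\<Delta>\<^sub>0. real (c \<delta>) * (\<beta> \<bullet> \<delta>) \<le> 0)"
      using sum_nonpos[of \<Delta>\<^sub>0 "\<lambda>\<delta>. real (c \<delta>) * (\<beta> \<bullet> \<delta>)"] by auto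
    then obtain \<gamma> where \<gamma>: "\<gamma> \<in> \<Delta>\<^sub>0" "real (c \<gamma>) * (\<beta> \<bullet> \<gamma>) > 0"
      by (auto simp: not_le)
    then have \<gamma>': "c \<gamma> \<noteq> 0" "\<beta> \<bullet> \<gamma> > 0"
      by (auto simp: zero_less_mult_iff)
    \<comment> \<open>Otherwise the \<gamma>-coordinate would vanish on the span of \<Sigma>, and so
      on \<beta>, although \<open>c \<gamma>\<close> is nonzero.\<close>
    have "\<gamma> \<in> \<Sigma>"
    proof (rule ccontr)
      assume "\<gamma> \<notin> \<Sigma>"
      obtain f :: "'a \<Rightarrow> real" where f: "linear f"
          "\<forall>\<delta>\<in>\<Delta>\<^sub>0. \<delta> \<noteq> \<gamma> \<longrightarrow> f \<delta> = 0"
          "\<forall>c. f (\<Sum>\<delta>\<in>\<Delta>\<^sub>0. c \<delta> *\<^sub>R \<delta>) = c \<gamma>"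
        using coordinate_functional[OF \<gamma>(1)] by blast
      have "f \<delta> = 0" if "\<delta> \<in> \<Sigma>" for \<delta>
        using f(2) that \<open>\<gamma> \<notin> \<Sigma>\<close> assms(1) by auto
      then have "f \<beta> = 0"
        using linear_eq_0_on_span f(1) less.prems(2) by blast
      moreover have "f \<beta> = c \<gamma>"
        using f(3)[rule_format, of "\<lambda>\<delta>. real (c \<delta>)"] by (simp flip: c)
      ultimately show False using \<gamma>' by simp
    qed
    show ?case
    proof (cases "\<beta> = \<gamma>")
      case True
      then show ?thesis using \<open>\<gamma> \<in> \<Sigma>\<close> by (simp add: root_refl_in_refl_group)
    next
      case False
      let ?\<beta> = "root_refl \<gamma> \<beta>"
      have pos: "?\<beta> \<in> pos"
        using simple_refl_pos \<gamma>(1) less.prems(1) False by blast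
      have span: "?\<beta> \<in> span \<Sigma>"
        unfolding root_refl_def using less.prems(2) span_base[OF \<open>\<gamma> \<in> \<Sigma>\<close>] by (intro span_diff span_scale)
      obtain m where m: "ht ?\<beta> = real m"
        using ht_nat[OF pos] by (auto simp: Nats_def)
      have "\<gamma> \<bullet> \<gamma> > 0"
        using simple_root[OF \<gamma>(1)] root_nonzero by auto
      then have "ht ?\<beta> < ht \<beta>"
        using ht \<gamma>(1) \<gamma>'(2) by (simp add: root_refl_def linear_diff linear_scale)
      then have "m < n" using m less.prems(3) by simp
      then have "root_refl ?\<beta> \<in> refl_group \<Sigma>"
        using less.IH pos span m by blast
      \<comment> \<open>The reflection in the shorter root, conjugated by the simple reflection in
        \<gamma>, is the reflection in \<beta>; all factors lie in the group.\<close>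
      moreover have "root_refl \<beta> = root_refl \<gamma> \<circ> (root_refl ?\<beta> \<circ> root_refl \<gamma>)"
        by (simp flip: orthogonal_transformation_root_refl_conj[OF orthogonal_transformation_root_refl]
            add: fun_eq_iff)
      ultimately show ?thesis
        using comp_in_refl_group root_refl_in_refl_group \<open>\<gamma> \<in> \<Sigma>\<close> by metis
    qed
  qed
  moreover obtain n where "ht \<beta> = real n"
    using ht_nat assms(2) by (auto simp: roots_spanned_def Nats_def)
  ultimately show ?thesis
    using assms(2) by (auto simp: roots_spanned_def)
qed

text \<open>It suffices to treat a generator. A simple reflection from \<Sigma> keeps \<beta>
  positive because \<beta> is not its own root, and preserves the spans of \<Sigma> and \<Sigma>'.
  Being an involution, it also preserves the outside of the span of \<Sigma>.\<close>

lemma refl_group_permutes_complement: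
  assumes "\<Sigma> \<subseteq> \<Delta>\<^sub>0" "\<Sigma> \<subseteq> \<Sigma>'" "w \<in> refl_group \<Sigma>"
    and "\<beta> \<in> roots_spanned \<Delta> \<Delta>\<^sub>0 \<Sigma>' - roots_spanned \<Delta> \<Delta>\<^sub>0 \<Sigma>"
  shows "w \<beta> \<in> roots_spanned \<Delta> \<Delta>\<^sub>0 \<Sigma>' - roots_spanned \<Delta> \<Delta>\<^sub>0 \<Sigma>"
  using assms(3,4)
proof (induction arbitrary: \<beta> rule: refl_group_induct)
  case id
  then show ?case by simp
next
  case (comp v w)
  then show ?case by simp
next
  case (refl \<gamma>)
  then have \<beta>: "\<beta> \<in> pos" "\<beta> \<in> span \<Sigma>'" "\<beta> \<notin> span \<Sigma>"
    by (auto simp: roots_spanned_def)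
  have span: "root_refl \<gamma> x \<in> span T" if "x \<in> span T" "\<Sigma> \<subseteq> T" for x T
    unfolding root_refl_def using that span_base[of \<gamma> T] refl(1) by (intro span_diff span_scale) auto
  have "\<beta> \<noteq> \<gamma>" using \<beta>(3) refl(1) span_base by blast
  then have "root_refl \<gamma> \<beta> \<in> pos"
    using simple_refl_pos \<beta>(1) refl(1) assms(1) by blast
  moreover have "root_refl \<gamma> \<beta> \<notin> span \<Sigma>"
    using span[of "root_refl \<gamma> \<beta>" \<Sigma>] \<beta>(3) by auto
  ultimately show ?case
    using span[OF \<beta>(2) assms(2)] by (auto simp: roots_spanned_def)
qed

end


section \<open>GKM graphs of reflection cosets\<close>

lemma comp_left_cancel: "inj g \<Longrightarrow> g \<circ> f = g \<circ> h \<longleftrightarrow> f = h"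
  by (auto simp: fun_eq_iff inj_eq)

text \<open>An edge recorded by a representative and a root. In the coset graphs below neither is
  unique: replacing \<open>w\<close> by \<open>w \<circ> c\<close> with \<open>c\<close> in
  \<open>C\<close> replaces \<beta> by its preimage under \<open>c\<close>.\<close>

definition coset_edge ::
  "('a::euclidean_space \<Rightarrow> 'a) set \<Rightarrow> ('a \<Rightarrow> 'a) \<Rightarrow> 'a \<Rightarrow> ('a \<Rightarrow> 'a) set \<times> ('a \<Rightarrow> 'a) set" where
  "coset_edge C w \<beta> = (lcoset w C, lcoset (w \<circ> root_refl \<beta>) C)"

lemma fst_coset_edge [simp]: "fst (coset_edge C w \<beta>) = lcoset w C"
  and snd_coset_edge [simp]: "snd (coset_edge C w \<beta>) = lcoset (w \<circ> root_refl \<beta>) C"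
  by (simp_all add: coset_edge_def)

lemma coset_edge_swap: "coset_edge C (w \<circ> root_refl \<beta>) \<beta> = prod.swap (coset_edge C w \<beta>)"
  by (simp add: coset_edge_def root_refl_comp_self')

text \<open>\<open>S\<close> need not be a group: the fiber of \<open>W/W\<^sub>1 \<rightarrow> W/W\<^sub>2\<close> over \<open>w W\<^sub>2\<close> is the case
  \<open>S = w W\<^sub>2\<close>, \<open>C = W\<^sub>1\<close>.\<close>

locale reflection_cosets =
  fixes S C :: "('a::euclidean_space \<Rightarrow> 'a) set" and R :: "'a set"
  assumes S_orthogonal: "w \<in> S \<Longrightarrow> orthogonal_transformation w"
    and C_orthogonal: "c \<in> C \<Longrightarrow> orthogonal_transformation c"
    and C_id: "id \<in> C"
    and C_comp: "c \<in> C \<Longrightarrow> d \<in> C \<Longrightarrow> c \<circ> d \<in> C"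
    and C_right_inverse: "c \<in> C \<Longrightarrow> \<exists>d\<in>C. c \<circ> d = id"
    and S_comp: "w \<in> S \<Longrightarrow> c \<in> C \<Longrightarrow> w \<circ> c \<in> S"
    and S_refl: "w \<in> S \<Longrightarrow> \<beta> \<in> R \<Longrightarrow> w \<circ> root_refl \<beta> \<in> S"
    and C_R: "c \<in> C \<Longrightarrow> \<beta> \<in> R \<Longrightarrow> c \<beta> \<in> R"
    and finite_R: "finite R"
    and R_parallel: "\<beta> \<in> R \<Longrightarrow> \<gamma> \<in> R \<Longrightarrow> \<beta> = t *\<^sub>R \<gamma> \<Longrightarrow> \<beta> = \<gamma>"
    and R_transversal: "\<beta> \<in> R \<Longrightarrow> \<exists>x. x \<bullet> \<beta> \<noteq> 0 \<and> (\<forall>c\<in>C. c x = x)"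
begin

lemma S_inj: "w \<in> S \<Longrightarrow> inj w"
  using S_orthogonal orthogonal_transformation_inj by blast

lemma S_linear: "w \<in> S \<Longrightarrow> linear w"
  using S_orthogonal orthogonal_transformation_linear by blast

lemma R_nonzero: "\<beta> \<in> R \<Longrightarrow> \<beta> \<noteq> 0"
  using R_transversal by force

text \<open>Injectivity of \<open>c\<close> turns the assumed right inverse into a two-sided
  one.\<close>

lemma C_inverse:
  assumes "c \<in> C"
  obtains d where "d \<in> C" "c \<circ> d = id" "d \<circ> c = id"
proof -
  obtain d where d: "d \<in> C" "c \<circ> d = id"
    using C_right_inverse assms by blast
  have "c \<circ> (d \<circ> c) = c \<circ> id"
    using d(2) by (simp add: fun_eq_iff)
  then have "d \<circ> c = id"
    using comp_left_cancel orthogonal_transformation_inj[OF C_orthogonal[OF assms]] by blast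
  with d that show thesis by blast
qed

section \<open>Cosets, edges and the choice of representatives\<close>

lemma lcoset_image: "w \<in> S \<Longrightarrow> lcoset w C = (\<circ>) w ` C"
  by (intro lcoset_eq orthogonal_transformation_bij S_orthogonal C_orthogonal)

lemma lcoset_self: "w \<in> S \<Longrightarrow> w \<in> lcoset w C"
  unfolding lcoset_image by (rule image_eqI[OF _ C_id]) simp

lemma lcoset_comp:
  assumes "w \<in> S" "c \<in> C"
  shows "lcoset (w \<circ> c) C = lcoset w C"
proof -
  obtain d where d: "d \<in> C" "c \<circ> d = id"
    using C_right_inverse assms(2) by blast
  have "(\<circ>) (w \<circ> c) ` C \<subseteq> (\<circ>) w ` C"
    using C_comp assms(2) by (auto simp: comp_assoc)
  moreover have "w \<circ> e \<in> (\<circ>) (w \<circ> c) ` C" if "e \<in> C" for e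
  proof (rule image_eqI)
    show "w \<circ> e = w \<circ> c \<circ> (d \<circ> e)"
      using d(2) by (simp add: fun_eq_iff)
    show "d \<circ> e \<in> C" using C_comp d(1) that by blast
  qed
  ultimately show ?thesis
    using assms by (auto simp: lcoset_image S_comp)
qed

lemma lcoset_eq_iff:
  assumes "w \<in> S" "v \<in> S"
  shows "lcoset w C = lcoset v C \<longleftrightarrow> (\<exists>c\<in>C. v = w \<circ> c)"
proof
  assume "lcoset w C = lcoset v C"
  then have "v \<in> lcoset w C" using lcoset_self assms by blast
  then show "\<exists>c\<in>C. v = w \<circ> c" using assms by (auto simp: lcoset_image)
qed (use assms lcoset_comp in auto)

text \<open>Moving \<open>c\<close> to the right past the reflection turns the root \<beta> into
  \<open>c \<beta>\<close>, after which \<open>c\<close> is absorbed by the coset.\<close>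

lemma lcoset_refl_conj:
  assumes "w \<in> S" "c \<in> C" "\<beta> \<in> R"
  shows "lcoset (w \<circ> c \<circ> root_refl \<beta>) C = lcoset (w \<circ> root_refl (c \<beta>)) C"
proof -
  have "w \<circ> c \<circ> root_refl \<beta> = w \<circ> root_refl (c \<beta>) \<circ> c"
    using orthogonal_transformation_root_refl_conj[OF C_orthogonal[OF assms(2)], of \<beta>]
    by (simp add: comp_assoc)
  then show ?thesis
    using lcoset_comp S_refl C_R assms by metis
qed

lemma coset_edge_comp:
  assumes "w \<in> S" "c \<in> C" "\<beta> \<in> R"
  shows "coset_edge C (w \<circ> c) \<beta> = coset_edge C w (c \<beta>)"
  unfolding coset_edge_def using assms lcoset_comp lcoset_refl_conj by blast

lemma lcoset_refl_inject:
  assumes w: "w \<in> S" and R: "\<beta> \<in> R" "\<gamma> \<in> R"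
    and eq: "lcoset (w \<circ> root_refl \<beta>) C = lcoset (w \<circ> root_refl \<gamma>) C"
  shows "\<beta> = \<gamma>"
proof -
  obtain c where c: "c \<in> C" "w \<circ> root_refl \<gamma> = w \<circ> root_refl \<beta> \<circ> c"
    using eq lcoset_eq_iff S_refl w R by meson
  then have "w \<circ> root_refl \<gamma> = w \<circ> (root_refl \<beta> \<circ> c)"
    by (simp add: comp_assoc)
  then have refl: "root_refl \<gamma> = root_refl \<beta> \<circ> c"
    using comp_left_cancel S_inj w by blast
  obtain x where x: "x \<bullet> \<gamma> \<noteq> 0" "c x = x"
    using R_transversal R(2) c(1) by blast
  define s where "s = 2 * (x \<bullet> \<gamma>) / (\<gamma> \<bullet> \<gamma>)"
  define t where "t = 2 * (x \<bullet> \<beta>) / (\<beta> \<bullet> \<beta>)"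
  have "s \<noteq> 0" using x(1) R_nonzero[OF R(2)] by (simp add: s_def)
  \<comment> \<open>As \<open>c\<close> fixes \<open>x\<close>, both reflections send
    \<open>x\<close> to the same vector, so the multiples subtracted from \<open>x\<close>
    agree.\<close>
  moreover have "s *\<^sub>R \<gamma> = t *\<^sub>R \<beta>"
    using fun_cong[OF refl, of x] x(2) by (simp add: root_refl_def s_def t_def)
  ultimately have "\<gamma> = (t / s) *\<^sub>R \<beta>"
    by (simp add: eq_vector_fraction_iff)
  then show ?thesis using R_parallel R by metis
qed

text \<open>Equality would put the reflection into \<open>C\<close>, where it would have to fix a
  vector not orthogonal to \<beta>.\<close>

lemma lcoset_refl_neq:
  assumes w: "w \<in> S" and R: "\<beta> \<in> R"
  shows "lcoset w C \<noteq> lcoset (w \<circ> root_refl \<beta>) C"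
proof
  assume "lcoset w C = lcoset (w \<circ> root_refl \<beta>) C"
  then obtain c where c: "c \<in> C" "w \<circ> root_refl \<beta> = w \<circ> c"
    using lcoset_eq_iff S_refl w R by meson
  then have refl: "root_refl \<beta> = c"
    using comp_left_cancel S_inj w by blast
  obtain x where x: "x \<bullet> \<beta> \<noteq> 0" "c x = x"
    using R_transversal R c(1) by blast
  then show False
    using fun_cong[OF refl, of x] R_nonzero[OF R] by (simp add: root_refl_def)
qed

lemma coset_edge_inject:
  assumes "w \<in> S" "\<beta> \<in> R" "\<gamma> \<in> R" "coset_edge C w \<beta> = coset_edge C w \<gamma>"
  shows "\<beta> = \<gamma>"
  using assms lcoset_refl_inject by (auto simp: coset_edge_def)

lemma inj_on_coset_edge: "w \<in> S \<Longrightarrow> inj_on (coset_edge C w) R"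
  using coset_edge_inject by (auto simp: inj_on_def)

lemma same_vertexE:
  assumes "w \<in> S" "v \<in> S" "lcoset w C = lcoset v C"
  obtains c where "c \<in> C" "v = w \<circ> c" "\<And>\<gamma>. \<gamma> \<in> R \<Longrightarrow> coset_edge C v \<gamma> = coset_edge C w (c \<gamma>)"
  using assms lcoset_eq_iff coset_edge_comp by blast

text \<open>Two descriptions of one edge differ by a single \<open>c\<close> in \<open>C\<close>
  acting on representative and root at once. This gives the uniqueness behind the \<open>THE\<close>
  descriptions of label and connection.\<close>

lemma coset_edge_eqE:
  assumes "w \<in> S" "v \<in> S" "\<beta> \<in> R" "\<gamma> \<in> R" "coset_edge C w \<beta> = coset_edge C v \<gamma>"
  obtains c where "c \<in> C" "v = w \<circ> c" "\<beta> = c \<gamma>"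
    "\<And>\<gamma>. \<gamma> \<in> R \<Longrightarrow> coset_edge C v \<gamma> = coset_edge C w (c \<gamma>)"
proof -
  have "lcoset w C = lcoset v C" using assms(5) by (simp add: coset_edge_def)
  then obtain c where c: "c \<in> C" "v = w \<circ> c" "\<And>\<gamma>. \<gamma> \<in> R \<Longrightarrow> coset_edge C v \<gamma> = coset_edge C w (c \<gamma>)"
    using same_vertexE assms(1,2) by blast
  moreover have "\<beta> = c \<gamma>"
    using c assms coset_edge_inject C_R by metis
  ultimately show thesis using that by blast
qed

end

text \<open>Labels and connection are prescribed only on edges, by formulas valid for every
  representative. Hence fibers, which inherit both functions from the total space, fall under the
  same predicate as the quotients themselves.\<close>

definition coset_gkm ::
  "('a::euclidean_space \<Rightarrow> 'a) set \<Rightarrow> ('a \<Rightarrow> 'a) set \<Rightarrow> 'a set \<Rightarrow> (('a \<Rightarrow> 'a) set, 'a) gkm \<Rightarrow> bool" where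
  "coset_gkm S C R G \<longleftrightarrow>
     verts G = (\<lambda>w. lcoset w C) ` S \<and>
     edges G = {coset_edge C w \<beta> | w \<beta>. w \<in> S \<and> \<beta> \<in> R} \<and>
     (\<forall>w\<in>S. \<forall>\<beta>\<in>R. axial G (coset_edge C w \<beta>) = w \<beta>) \<and>
     (\<forall>w\<in>S. \<forall>\<beta>\<in>R. \<forall>\<gamma>\<in>R.
        conn G (coset_edge C w \<beta>) (coset_edge C w \<gamma>) = coset_edge C (w \<circ> root_refl \<beta>) \<gamma>)"

context reflection_cosets
begin

lemma coset_gkm_quotient: "coset_gkm S C R (quotient_gkm S C R)"
proof -
  have "axial (quotient_gkm S C R) (coset_edge C w \<beta>) = w \<beta>" if w: "w \<in> S" "\<beta> \<in> R" for w \<beta>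
  proof -
    have "(THE l. \<exists>v\<in>S. \<exists>\<gamma>\<in>R. coset_edge C w \<beta> = coset_edge C v \<gamma> \<and> l = v \<gamma>) = w \<beta>"
    proof (rule the_equality)
      show "\<exists>v\<in>S. \<exists>\<gamma>\<in>R. coset_edge C w \<beta> = coset_edge C v \<gamma> \<and> w \<beta> = v \<gamma>"
        using w by blast
    next
      fix l assume "\<exists>v\<in>S. \<exists>\<gamma>\<in>R. coset_edge C w \<beta> = coset_edge C v \<gamma> \<and> l = v \<gamma>"
      then obtain v \<gamma> where v: "v \<in> S" "\<gamma> \<in> R" "coset_edge C w \<beta> = coset_edge C v \<gamma>" "l = v \<gamma>"
        by blast
      show "l = w \<beta>"
        using coset_edge_eqE[OF w(1) v(1) w(2) v(2,3)] v(4) by (metis comp_apply)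
    qed
    then show ?thesis
      by (simp add: quotient_gkm_def coset_edge_def)
  qed
  moreover have "conn (quotient_gkm S C R) (coset_edge C w \<beta>) (coset_edge C w \<gamma>) =
      coset_edge C (w \<circ> root_refl \<beta>) \<gamma>" if w: "w \<in> S" "\<beta> \<in> R" "\<gamma> \<in> R" for w \<beta> \<gamma>
  proof -
    have "(THE e. \<exists>v\<in>S. \<exists>\<beta>'\<in>R. \<exists>\<gamma>'\<in>R. coset_edge C w \<beta> = coset_edge C v \<beta>' \<and>
        coset_edge C w \<gamma> = coset_edge C v \<gamma>' \<and> e = coset_edge C (v \<circ> root_refl \<beta>') \<gamma>') =
        coset_edge C (w \<circ> root_refl \<beta>) \<gamma>"
    proof (rule the_equality)
      show "\<exists>v\<in>S. \<exists>\<beta>'\<in>R. \<exists>\<gamma>'\<in>R. coset_edge C w \<beta> = coset_edge C v \<beta>' \<and>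
          coset_edge C w \<gamma> = coset_edge C v \<gamma>' \<and>
          coset_edge C (w \<circ> root_refl \<beta>) \<gamma> = coset_edge C (v \<circ> root_refl \<beta>') \<gamma>'"
        using w by blast
    next
      fix e assume "\<exists>v\<in>S. \<exists>\<beta>'\<in>R. \<exists>\<gamma>'\<in>R. coset_edge C w \<beta> = coset_edge C v \<beta>' \<and>
        coset_edge C w \<gamma> = coset_edge C v \<gamma>' \<and> e = coset_edge C (v \<circ> root_refl \<beta>') \<gamma>'"
      then obtain v \<beta>' \<gamma>' where v: "v \<in> S" "\<beta>' \<in> R" "\<gamma>' \<in> R"
          "coset_edge C w \<beta> = coset_edge C v \<beta>'" "coset_edge C w \<gamma> = coset_edge C v \<gamma>'"
        and e: "e = coset_edge C (v \<circ> root_refl \<beta>') \<gamma>'"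
        by blast
      obtain c where c: "c \<in> C" "v = w \<circ> c" "\<beta> = c \<beta>'"
          "\<And>\<gamma>. \<gamma> \<in> R \<Longrightarrow> coset_edge C v \<gamma> = coset_edge C w (c \<gamma>)"
        using coset_edge_eqE[OF w(1) v(1) w(2) v(2,4)] by blast
      \<comment> \<open>Both edges start at the same vertex, so the \<open>c\<close> found from the
        first edge also relates the roots of the second.\<close>
      have "\<gamma> = c \<gamma>'"
        using c v w coset_edge_inject C_R by metis
      \<comment> \<open>The representatives at the far end again differ by \<open>c\<close>, so the
        two candidate edges coincide.\<close>
      have "v \<circ> root_refl \<beta>' = w \<circ> root_refl \<beta> \<circ> c"
        unfolding c(2,3) comp_assoc
        using orthogonal_transformation_root_refl_conj[OF C_orthogonal[OF c(1)], of \<beta>'] by simp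
      then show "e = coset_edge C (w \<circ> root_refl \<beta>) \<gamma>"
        unfolding e \<open>\<gamma> = c \<gamma>'\<close> using coset_edge_comp S_refl c(1) w v(3) by metis
    qed
    then show ?thesis
      by (simp add: quotient_gkm_def coset_edge_def)
  qed
  ultimately show ?thesis
    unfolding coset_gkm_def by (auto simp: quotient_gkm_def coset_edge_def)
qed

section \<open>The GKM axioms for coset graphs\<close>

context
  fixes G :: "(('a \<Rightarrow> 'a) set, 'a) gkm"
  assumes G: "coset_gkm S C R G"
begin

lemma verts_eq: "verts G = (\<lambda>w. lcoset w C) ` S"
  and edges_eq: "edges G = {coset_edge C w \<beta> | w \<beta>. w \<in> S \<and> \<beta> \<in> R}"
  and axial_eq: "w \<in> S \<Longrightarrow> \<beta> \<in> R \<Longrightarrow> axial G (coset_edge C w \<beta>) = w \<beta>"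
  and conn_eq: "w \<in> S \<Longrightarrow> \<beta> \<in> R \<Longrightarrow> \<gamma> \<in> R \<Longrightarrow>
    conn G (coset_edge C w \<beta>) (coset_edge C w \<gamma>) = coset_edge C (w \<circ> root_refl \<beta>) \<gamma>"
  using G by (auto simp: coset_gkm_def)

text \<open>One fixed representative describes all edges at its vertex: any other one differs by an
  element of \<open>C\<close>, which maps \<open>R\<close> into itself.\<close>

lemma edges_at_eq:
  assumes "w \<in> S"
  shows "edges_at G (lcoset w C) = coset_edge C w ` R"
proof -
  have "coset_edge C v \<beta> \<in> coset_edge C w ` R"
    if v: "v \<in> S" "\<beta> \<in> R" "lcoset v C = lcoset w C" for v \<beta>
  proof -
    obtain c where "c \<in> C" "\<And>\<gamma>. \<gamma> \<in> R \<Longrightarrow> coset_edge C v \<gamma> = coset_edge C w (c \<gamma>)"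
      using same_vertexE[OF assms v(1) v(3)[symmetric]] by blast
    then show ?thesis using v(2) C_R by blast
  qed
  then show ?thesis
    unfolding edges_at_def edges_eq using assms by auto
qed

lemma edge_in_edges: "w \<in> S \<Longrightarrow> \<beta> \<in> R \<Longrightarrow> coset_edge C w \<beta> \<in> edges G"
  by (auto simp: edges_eq)

lemma regular_graph_coset_gkm: "regular_graph G"
proof -
  have "edges G \<subseteq> verts G \<times> verts G"
    by (auto simp: edges_eq verts_eq coset_edge_def S_refl)
  moreover have "irrefl (edges G)"
    by (auto simp: irrefl_def edges_eq coset_edge_def dest: lcoset_refl_neq)
  moreover have "sym (edges G)"
  proof (rule symI)
    fix p q assume "(p, q) \<in> edges G"
    then obtain w \<beta> where w: "w \<in> S" "\<beta> \<in> R" "(p, q) = coset_edge C w \<beta>"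
      by (auto simp: edges_eq)
    then have "(q, p) = coset_edge C (w \<circ> root_refl \<beta>) \<beta>"
      by (simp add: coset_edge_swap flip: w(3))
    then show "(q, p) \<in> edges G"
      using edge_in_edges S_refl w by metis
  qed
  moreover have "finite (edges_at G p) \<and> card (edges_at G p) = card R" if "p \<in> verts G" for p
    using that finite_R by (auto simp: verts_eq edges_at_eq card_image inj_on_coset_edge)
  ultimately show ?thesis
    unfolding regular_graph_def by blast
qed

text \<open>In terms of representatives the connection keeps the root \<gamma> and replaces
  \<open>w\<close> by \<open>?v\<close>; along the reversed edge, \<gamma> is kept again and
  \<open>w\<close> returns.\<close>

lemma is_connection_coset_gkm: "is_connection G"
proof -
  have "bij_betw (conn G (p, q)) (edges_at G p) (edges_at G q) \<and> conn G (p, q) (p, q) = (q, p) \<and>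
      (\<forall>e\<in>edges_at G p. conn G (q, p) (conn G (p, q) e) = e)" if pq: "(p, q) \<in> edges G" for p q
  proof -
    obtain w \<beta> where w: "w \<in> S" "\<beta> \<in> R" and e: "(p, q) = coset_edge C w \<beta>"
      using pq by (auto simp: edges_eq)
    let ?v = "w \<circ> root_refl \<beta>"
    have v: "?v \<in> S" using S_refl w by blast
    have e': "(q, p) = coset_edge C ?v \<beta>"
      by (simp add: coset_edge_swap flip: e)
    have p: "edges_at G p = coset_edge C w ` R" and q: "edges_at G q = coset_edge C ?v ` R"
      using e edges_at_eq[OF w(1)] edges_at_eq[OF v] by (auto simp: coset_edge_def)
    have conn: "conn G (p, q) (coset_edge C w \<gamma>) = coset_edge C ?v \<gamma>" if "\<gamma> \<in> R" for \<gamma>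
      unfolding e using w that by (rule conn_eq)
    have conn': "conn G (q, p) (coset_edge C ?v \<gamma>) = coset_edge C w \<gamma>" if "\<gamma> \<in> R" for \<gamma>
      unfolding e' conn_eq[OF v w(2) that] root_refl_comp_self' ..
    have "bij_betw (conn G (p, q)) (edges_at G p) (edges_at G q)"
      unfolding p q by (rule bij_betw_byWitness[where f' = "conn G (q, p)"]) (auto simp: conn conn')
    moreover have "conn G (p, q) (p, q) = (q, p)"
      using conn[OF w(2)] unfolding e'[symmetric] e[symmetric] .
    ultimately show ?thesis
      unfolding p by (auto simp: conn conn')
  qed
  then show ?thesis
    unfolding is_connection_def by blast
qed

lemma is_axial_coset_gkm: "is_axial G"
proof -
  have "axial G (q, p) = - axial G (p, q)" if pq: "(p, q) \<in> edges G" for p q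
  proof -
    obtain w \<beta> where w: "w \<in> S" "\<beta> \<in> R" and e: "(p, q) = coset_edge C w \<beta>"
      using pq by (auto simp: edges_eq)
    have "(q, p) = coset_edge C (w \<circ> root_refl \<beta>) \<beta>"
      by (simp add: coset_edge_swap flip: e)
    then show ?thesis
      using e axial_eq[OF w] axial_eq[OF S_refl[OF w] w(2)] linear_neg[OF S_linear[OF w(1)]]
      by (simp add: root_refl_self)
  qed
  moreover have "axial G e \<noteq> axial G e' \<and> independent {axial G e, axial G e'}"
    if p: "p \<in> verts G" "e \<in> edges_at G p" "e' \<in> edges_at G p" "e \<noteq> e'" for p e e'
  proof -
    obtain w where w: "w \<in> S" "p = lcoset w C"
      using p(1) by (auto simp: verts_eq)
    obtain \<beta> \<gamma> where \<beta>\<gamma>: "\<beta> \<in> R" "\<gamma> \<in> R" "e = coset_edge C w \<beta>" "e' = coset_edge C w \<gamma>"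
      using p edges_at_eq w by auto
    have neq: "\<beta> \<noteq> \<gamma>" using p(4) \<beta>\<gamma> by auto
    have "\<beta> \<notin> span {\<gamma>}"
      using R_parallel \<beta>\<gamma>(1,2) neq by (auto simp: span_singleton)
    then have "independent {\<beta>, \<gamma>}"
      using R_nonzero[OF \<beta>\<gamma>(2)] by (simp add: independent_insert dependent_single)
    \<comment> \<open>Both edges are described with the same \<open>w\<close>, so their labels are
      the images of two nonparallel roots under one injective linear map.\<close>
    then have "independent (w ` {\<beta>, \<gamma>})"
      using S_linear inj_on_subset[OF S_inj] w(1) by (intro linear_independent_injective_image) auto
    then show ?thesis
      using \<beta>\<gamma> w(1) neq axial_eq inj_eq[OF S_inj[OF w(1)]] by simp
  qed
  moreover have "\<exists>c. axial G (conn G e e') - axial G e' = c *\<^sub>R axial G e"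
    if e: "e \<in> edges G" "e' \<in> edges_at G (fst e)" for e e'
  proof -
    obtain w \<beta> where w: "w \<in> S" "\<beta> \<in> R" "e = coset_edge C w \<beta>"
      using e(1) by (auto simp: edges_eq)
    obtain \<gamma> where \<gamma>: "\<gamma> \<in> R" "e' = coset_edge C w \<gamma>"
      using e(2) edges_at_eq w by auto
    have "axial G (conn G e e') = w (root_refl \<beta> \<gamma>)"
      using w \<gamma> conn_eq axial_eq S_refl by simp
    \<comment> \<open>The difference is the image under \<open>w\<close> of the reflected \<gamma>
      minus \<gamma>, which is a multiple of \<beta>.\<close>
    then have "axial G (conn G e e') - axial G e' = (- (2 * (\<gamma> \<bullet> \<beta>) / (\<beta> \<bullet> \<beta>))) *\<^sub>R axial G e"
      using w \<gamma> axial_eq S_linear[OF w(1)] by (simp add: root_refl_def linear_diff linear_scale)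
    then show ?thesis ..
  qed
  ultimately show ?thesis
    unfolding is_axial_def by blast
qed

lemma gkm_graph_coset_gkm: "gkm_graph G"
  using regular_graph_coset_gkm is_connection_coset_gkm is_axial_coset_gkm
  by (simp add: gkm_graph_def)

end

end

text \<open>Left multiplication by \<open>g\<close> keeps the root of an edge and applies
  \<open>g\<close> to its label. The values of \<Phi> are prescribed only on cosets of elements of
  \<open>S\<close>, so that \<Phi> may also be a transport map defined through lifts.\<close>

lemma gkm_iso_left_mult:
  assumes S: "reflection_cosets S C R" and T: "reflection_cosets T C R"
    and G: "coset_gkm S C R G" and H: "coset_gkm T C R H"
    and g: "orthogonal_transformation g" and T_eq: "T = (\<circ>) g ` S"
    and \<Phi>: "\<And>w. w \<in> S \<Longrightarrow> \<Phi> (lcoset w C) = lcoset (g \<circ> w) C"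
  shows "gkm_iso G H \<Phi> g"
proof -
  interpret S: reflection_cosets S C R by fact
  interpret T: reflection_cosets T C R by fact
  have inj: "inj g" and lin: "linear g"
    using g orthogonal_transformation_inj orthogonal_transformation_linear by blast+
  have gT: "g \<circ> w \<in> T" if "w \<in> S" for w using that T_eq by blast
  have eq: "lcoset (g \<circ> w) C = lcoset (g \<circ> v) C \<longleftrightarrow> lcoset w C = lcoset v C"
    if "w \<in> S" "v \<in> S" for w v
    unfolding S.lcoset_eq_iff[OF that] T.lcoset_eq_iff[OF gT[OF that(1)] gT[OF that(2)]]
    by (simp only: comp_assoc comp_left_cancel[OF inj])
  have edge: "map_prod \<Phi> \<Phi> (coset_edge C w \<beta>) = coset_edge C (g \<circ> w) \<beta>" if "w \<in> S" "\<beta> \<in> R" for w \<beta>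
    using \<Phi>[OF that(1)] \<Phi>[OF S.S_refl[OF that]] by (simp add: coset_edge_def comp_assoc)
  have axial: "axial H (map_prod \<Phi> \<Phi> e) = g (axial G e)" if e: "e \<in> edges G" for e
  proof -
    obtain w \<beta> where "w \<in> S" "\<beta> \<in> R" "e = coset_edge C w \<beta>"
      using e S.edges_eq[OF G] by blast
    then show ?thesis
      using edge S.axial_eq[OF G] T.axial_eq[OF H] gT by simp
  qed
  have edges: "edges H = map_prod \<Phi> \<Phi> ` edges G"
  proof (intro equalityI subsetI)
    fix e assume "e \<in> edges H"
    then obtain w \<beta> where "w \<in> S" "\<beta> \<in> R" "e = coset_edge C (g \<circ> w) \<beta>"
      unfolding T.edges_eq[OF H] T_eq by blast
    then show "e \<in> map_prod \<Phi> \<Phi> ` edges G"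
      using edge S.edge_in_edges[OF G] by (metis image_eqI)
  next
    fix e assume "e \<in> map_prod \<Phi> \<Phi> ` edges G"
    then obtain e' where e': "e' \<in> edges G" "e = map_prod \<Phi> \<Phi> e'"
      by (elim imageE)
    then obtain w \<beta> where "w \<in> S" "\<beta> \<in> R" "e = map_prod \<Phi> \<Phi> (coset_edge C w \<beta>)"
      unfolding S.edges_eq[OF G] by blast
    then show "e \<in> edges H"
      using edge T.edge_in_edges[OF H] gT by metis
  qed
  have vert_inj: "inj_on \<Phi> (verts G)"
    unfolding S.verts_eq[OF G] by (auto intro!: inj_onI simp: \<Phi> eq)
  have "\<Phi> ` verts G = verts H"
    unfolding S.verts_eq[OF G] T.verts_eq[OF H] T_eq by (auto simp: \<Phi> image_iff)
  moreover have "(p, q) \<in> edges G \<longleftrightarrow> (\<Phi> p, \<Phi> q) \<in> edges H"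
    if "p \<in> verts G" "q \<in> verts G" for p q
  proof
    assume "(\<Phi> p, \<Phi> q) \<in> edges H"
    \<comment> \<open>An edge of \<open>H\<close> comes from some edge of \<open>G\<close>;
      injectivity on vertices shows that this edge is \<open>(p, q)\<close>.\<close>
    then obtain p' q' where "(p', q') \<in> edges G" "\<Phi> p = \<Phi> p'" "\<Phi> q = \<Phi> q'"
      unfolding edges by auto
    moreover have "edges G \<subseteq> verts G \<times> verts G"
      using S.regular_graph_coset_gkm[OF G] by (simp add: regular_graph_def)
    ultimately have "p = p'" "q = q'"
      using that inj_onD[OF vert_inj, of p p'] inj_onD[OF vert_inj, of q q'] by blast+
    with \<open>(p', q') \<in> edges G\<close> show "(p, q) \<in> edges G" by simp
  qed (auto simp: edges)
  ultimately have "graph_iso G H \<Phi>"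
    using vert_inj by (simp add: graph_iso_def bij_betw_def)
  moreover have "axial H ` edges H = g ` axial G ` edges G"
    unfolding edges image_image using axial by (intro image_cong) auto
  then have "label_span H = g ` label_span G"
    using lin by (simp add: label_span_def linear_span_image)
  then have "bij_betw g (label_span G) (label_span H)"
    using inj_on_subset[OF inj subset_UNIV] by (simp add: bij_betw_def)
  ultimately show ?thesis
    using S.gkm_graph_coset_gkm[OF G] T.gkm_graph_coset_gkm[OF H] lin axial
    by (auto simp: gkm_iso_def)
qed


section \<open>Towers of reflection cosets\<close>

text \<open>The roots in \<open>R\<^sub>2\<close> give the horizontal edges, those in
  \<open>R\<^sub>1 - R\<^sub>2\<close> the vertical ones; \<open>fiber_refl\<close> is what keeps
  the latter inside a fiber.\<close>

locale reflection_coset_tower =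
  G: reflection_cosets A C\<^sub>1 R\<^sub>1 + B: reflection_cosets A C\<^sub>2 R\<^sub>2
  for A C\<^sub>1 C\<^sub>2 :: "('a::euclidean_space \<Rightarrow> 'a) set" and R\<^sub>1 R\<^sub>2 +
  assumes C_mono: "C\<^sub>1 \<subseteq> C\<^sub>2" and R_mono: "R\<^sub>2 \<subseteq> R\<^sub>1"
    and fiber_refl: "\<beta> \<in> R\<^sub>1 \<Longrightarrow> \<beta> \<notin> R\<^sub>2 \<Longrightarrow> root_refl \<beta> \<in> C\<^sub>2"
begin

abbreviation "total_gkm \<equiv> quotient_gkm A C\<^sub>1 R\<^sub>1"
abbreviation "base_gkm \<equiv> quotient_gkm A C\<^sub>2 R\<^sub>2"
abbreviation "proj \<equiv> coset_proj A C\<^sub>1 C\<^sub>2"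

lemmas coset_gkm_total = G.coset_gkm_quotient
lemmas coset_gkm_base = B.coset_gkm_quotient

text \<open>Stated for any \<open>S\<close> stable under \<open>C\<^sub>2\<close>, so that it covers
  both the fibers, with \<open>S\<close> a coset of \<open>C\<^sub>2\<close>, and the typical fiber,
  with \<open>S = C\<^sub>2\<close>.\<close>

lemma fiber_cosets:
  assumes S: "S \<subseteq> Collect orthogonal_transformation"
    and S_comp: "\<And>w c. w \<in> S \<Longrightarrow> c \<in> C\<^sub>2 \<Longrightarrow> w \<circ> c \<in> S"
  shows "reflection_cosets S C\<^sub>1 (R\<^sub>1 - R\<^sub>2)"
proof
  fix c \<beta> assume c: "c \<in> C\<^sub>1" and \<beta>: "\<beta> \<in> R\<^sub>1 - R\<^sub>2"
  obtain d where d: "d \<in> C\<^sub>1" "d \<circ> c = id"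
    using G.C_inverse[OF c] by blast
  \<comment> \<open>The inverse \<open>d\<close> also preserves \<open>R\<^sub>2\<close>, so it
    would bring \<open>c \<beta>\<close> back to \<beta> inside \<open>R\<^sub>2\<close>.\<close>
  have "c \<beta> \<notin> R\<^sub>2"
  proof
    assume "c \<beta> \<in> R\<^sub>2"
    then have "d (c \<beta>) \<in> R\<^sub>2" using B.C_R d(1) C_mono by blast
    then show False using \<beta> fun_cong[OF d(2), of \<beta>] by simp
  qed
  then show "c \<beta> \<in> R\<^sub>1 - R\<^sub>2" using G.C_R c \<beta> by blast
qed (use assms C_mono fiber_refl G.C_orthogonal G.C_id G.C_comp G.C_right_inverse G.finite_R
    G.R_parallel G.R_transversal in blast)+

section \<open>The projection, horizontal edges and lifts\<close>

lemma proj_lcoset: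
  assumes "w \<in> A"
  shows "proj (lcoset w C\<^sub>1) = lcoset w C\<^sub>2"
  unfolding coset_proj_def
proof (rule the_equality)
  fix Q assume "\<exists>v\<in>A. lcoset w C\<^sub>1 = lcoset v C\<^sub>1 \<and> Q = lcoset v C\<^sub>2"
  then obtain v where v: "v \<in> A" "lcoset w C\<^sub>1 = lcoset v C\<^sub>1" "Q = lcoset v C\<^sub>2"
    by blast
  then obtain c where "c \<in> C\<^sub>1" "v = w \<circ> c"
    using G.lcoset_eq_iff assms by blast
  then show "Q = lcoset w C\<^sub>2"
    using v(3) B.lcoset_comp assms C_mono by auto
qed (use assms in blast)

lemma proj_edge:
  assumes "w \<in> A" "\<beta> \<in> R\<^sub>1"
  shows "map_prod proj proj (coset_edge C\<^sub>1 w \<beta>) = coset_edge C\<^sub>2 w \<beta>"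
  using proj_lcoset[OF assms(1)] proj_lcoset[OF G.S_refl[OF assms]] by (simp add: coset_edge_def)

text \<open>For \<beta> in \<open>R\<^sub>2\<close> the reflection moves the coset of
  \<open>C\<^sub>2\<close>; otherwise it lies in \<open>C\<^sub>2\<close> and is absorbed.\<close>

lemma proj_vertex_iff:
  assumes "w \<in> A" "\<beta> \<in> R\<^sub>1"
  shows "lcoset w C\<^sub>2 = lcoset (w \<circ> root_refl \<beta>) C\<^sub>2 \<longleftrightarrow> \<beta> \<notin> R\<^sub>2"
  using B.lcoset_refl_neq[OF assms(1)] B.lcoset_comp[OF assms(1)] fiber_refl[OF assms(2)] by metis

lemma vertical_iff:
  assumes "w \<in> A" "\<beta> \<in> R\<^sub>1"
  shows "vertical proj (coset_edge C\<^sub>1 w \<beta>) \<longleftrightarrow> \<beta> \<notin> R\<^sub>2"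
  using proj_vertex_iff[OF assms] proj_lcoset[OF assms(1)] proj_lcoset[OF G.S_refl[OF assms]]
  by (simp add: vertical_def)

lemma base_loop: "(p, p) \<notin> edges base_gkm"
  using B.regular_graph_coset_gkm[OF coset_gkm_base] by (simp add: regular_graph_def irrefl_def)

lemma horizontal_iff:
  assumes "w \<in> A" "\<beta> \<in> R\<^sub>1"
  shows "horizontal base_gkm proj (coset_edge C\<^sub>1 w \<beta>) \<longleftrightarrow> \<beta> \<in> R\<^sub>2"
proof
  assume "horizontal base_gkm proj (coset_edge C\<^sub>1 w \<beta>)"
  then have "coset_edge C\<^sub>2 w \<beta> \<in> edges base_gkm"
    using proj_edge[OF assms] by (simp add: horizontal_def)
  \<comment> \<open>A root outside \<open>R\<^sub>2\<close> would project to a loop, and the base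
    has none.\<close>
  then show "\<beta> \<in> R\<^sub>2"
    using proj_vertex_iff[OF assms] base_loop by (auto simp: coset_edge_def)
next
  assume "\<beta> \<in> R\<^sub>2"
  then show "horizontal base_gkm proj (coset_edge C\<^sub>1 w \<beta>)"
    using proj_edge[OF assms] B.edge_in_edges[OF coset_gkm_base assms(1)] by (simp add: horizontal_def)
qed

lemma horizontal_at_eq:
  assumes "w \<in> A"
  shows "horizontal_at total_gkm base_gkm proj (lcoset w C\<^sub>1) = coset_edge C\<^sub>1 w ` R\<^sub>2"
  using G.edges_at_eq[OF coset_gkm_total assms] horizontal_iff[OF assms] R_mono
  by (auto simp: horizontal_at_def)

lemma lift_eq:
  assumes "w \<in> A" "\<beta> \<in> R\<^sub>2"
  shows "lift total_gkm base_gkm proj (coset_edge C\<^sub>2 w \<beta>) (lcoset w C\<^sub>1) = coset_edge C\<^sub>1 w \<beta>"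
  unfolding lift_def horizontal_at_eq[OF assms(1)]
proof (rule the_equality)
  show "coset_edge C\<^sub>1 w \<beta> \<in> coset_edge C\<^sub>1 w ` R\<^sub>2 \<and>
      map_prod proj proj (coset_edge C\<^sub>1 w \<beta>) = coset_edge C\<^sub>2 w \<beta>"
    using proj_edge assms R_mono by blast
next
  fix e assume "e \<in> coset_edge C\<^sub>1 w ` R\<^sub>2 \<and> map_prod proj proj e = coset_edge C\<^sub>2 w \<beta>"
  then obtain \<gamma> where "\<gamma> \<in> R\<^sub>2" "e = coset_edge C\<^sub>1 w \<gamma>" "coset_edge C\<^sub>2 w \<gamma> = coset_edge C\<^sub>2 w \<beta>"
    using proj_edge assms R_mono by auto
  then show "e = coset_edge C\<^sub>1 w \<beta>"
    using B.coset_edge_inject assms by blast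
qed

text \<open>For a fixed representative, horizontal edges above and edges below are both indexed by
  \<open>R\<^sub>2\<close>, and the projection keeps the index.\<close>

lemma graph_fibration: "graph_fibration total_gkm base_gkm proj"
proof -
  have "graph_morphism total_gkm base_gkm proj"
    unfolding graph_morphism_def
  proof (intro conjI ballI)
    show "proj ` verts total_gkm \<subseteq> verts base_gkm"
      by (auto simp: G.verts_eq[OF coset_gkm_total] B.verts_eq[OF coset_gkm_base] proj_lcoset)
    fix e assume "e \<in> edges total_gkm"
    then obtain w \<beta> where w: "w \<in> A" "\<beta> \<in> R\<^sub>1" and e: "e = coset_edge C\<^sub>1 w \<beta>"
      by (auto simp: G.edges_eq[OF coset_gkm_total])
    have "vertical proj e \<or> horizontal base_gkm proj e"
      using vertical_iff[OF w] horizontal_iff[OF w] e by blast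
    then show "case e of (p, q) \<Rightarrow> proj p = proj q \<or> (proj p, proj q) \<in> edges base_gkm"
      by (cases e) (simp add: vertical_def horizontal_def)
  qed
  moreover have "bij_betw (map_prod proj proj) (horizontal_at total_gkm base_gkm proj q) (edges_at base_gkm (proj q))"
    if q: "q \<in> verts total_gkm" for q
  proof -
    obtain w where w: "w \<in> A" "q = lcoset w C\<^sub>1"
      using q by (auto simp: G.verts_eq[OF coset_gkm_total])
    have edge: "map_prod proj proj (coset_edge C\<^sub>1 w \<beta>) = coset_edge C\<^sub>2 w \<beta>" if "\<beta> \<in> R\<^sub>2" for \<beta>
      using proj_edge w(1) R_mono that by blast
    have "map_prod proj proj ` coset_edge C\<^sub>1 w ` R\<^sub>2 = coset_edge C\<^sub>2 w ` R\<^sub>2"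
      unfolding image_image using edge by (rule image_cong[OF refl])
    moreover have "inj_on (map_prod proj proj) (coset_edge C\<^sub>1 w ` R\<^sub>2)"
    proof (rule inj_onI)
      fix e e' assume "e \<in> coset_edge C\<^sub>1 w ` R\<^sub>2" "e' \<in> coset_edge C\<^sub>1 w ` R\<^sub>2"
        and eq: "map_prod proj proj e = map_prod proj proj e'"
      then obtain \<beta> \<gamma> where "\<beta> \<in> R\<^sub>2" "\<gamma> \<in> R\<^sub>2" "e = coset_edge C\<^sub>1 w \<beta>" "e' = coset_edge C\<^sub>1 w \<gamma>"
        by blast
      then show "e = e'"
        using eq edge B.coset_edge_inject[OF w(1)] by metis
    qed
    ultimately show ?thesis
      unfolding bij_betw_def w(2) horizontal_at_eq[OF w(1)] proj_lcoset[OF w(1)]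
        B.edges_at_eq[OF coset_gkm_base w(1)] by blast
  qed
  ultimately show ?thesis
    by (simp add: graph_fibration_def)
qed

text \<open>The same \<open>w\<close> represents the vertex above and the edge below, which is the
  form in which \<open>lift_eq\<close> applies.\<close>

lemma base_edges_atE:
  assumes "p \<in> verts total_gkm" "e \<in> edges_at base_gkm (proj p)"
  obtains w \<beta> where "w \<in> A" "\<beta> \<in> R\<^sub>2" "p = lcoset w C\<^sub>1" "e = coset_edge C\<^sub>2 w \<beta>"
  using assms B.edges_at_eq[OF coset_gkm_base] by (auto simp: G.verts_eq[OF coset_gkm_total] proj_lcoset)

lemma gkm_fibration: "gkm_fibration total_gkm base_gkm proj"
proof -
  have "axial total_gkm (lift total_gkm base_gkm proj e p) = axial base_gkm e"
    if "p \<in> verts total_gkm" "e \<in> edges_at base_gkm (proj p)" for p e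
    using base_edges_atE[OF that] lift_eq G.axial_eq[OF coset_gkm_total] B.axial_eq[OF coset_gkm_base] R_mono
    by (metis subsetD)
  moreover have "(horizontal base_gkm proj e' \<longrightarrow> horizontal base_gkm proj (conn total_gkm e e')) \<and>
      (vertical proj e' \<longrightarrow> vertical proj (conn total_gkm e e'))"
    if e: "e \<in> edges total_gkm" "e' \<in> edges_at total_gkm (fst e)" for e e'
  proof -
    obtain w \<beta> where w: "w \<in> A" "\<beta> \<in> R\<^sub>1" "e = coset_edge C\<^sub>1 w \<beta>"
      using e(1) by (auto simp: G.edges_eq[OF coset_gkm_total])
    obtain \<gamma> where \<gamma>: "\<gamma> \<in> R\<^sub>1" "e' = coset_edge C\<^sub>1 w \<gamma>"
      using e(2) G.edges_at_eq[OF coset_gkm_total] w by auto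
    \<comment> \<open>The connection keeps the root \<gamma>, and the root alone decides between
      horizontal and vertical.\<close>
    have "conn total_gkm e e' = coset_edge C\<^sub>1 (w \<circ> root_refl \<beta>) \<gamma>"
      using G.conn_eq[OF coset_gkm_total] w \<gamma> by blast
    then show ?thesis
      using horizontal_iff vertical_iff w \<gamma> G.S_refl[OF w(1,2)] by simp
  qed
  moreover have "conn total_gkm (lift total_gkm base_gkm proj e p) (lift total_gkm base_gkm proj e' p) =
      lift total_gkm base_gkm proj (conn base_gkm e e') (snd (lift total_gkm base_gkm proj e p))"
    if p: "p \<in> verts total_gkm" "e \<in> edges_at base_gkm (proj p)" "e' \<in> edges_at base_gkm (proj p)" for p e e'
  proof -
    obtain w \<beta> where w: "w \<in> A" "\<beta> \<in> R\<^sub>2" "p = lcoset w C\<^sub>1" "e = coset_edge C\<^sub>2 w \<beta>"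
      using base_edges_atE[OF p(1,2)] .
    obtain \<gamma> where \<gamma>: "\<gamma> \<in> R\<^sub>2" "e' = coset_edge C\<^sub>2 w \<gamma>"
      using p(3) B.edges_at_eq[OF coset_gkm_base] w proj_lcoset by auto
    have "w \<circ> root_refl \<beta> \<in> A" using B.S_refl w by blast
    then show ?thesis
      using w \<gamma> lift_eq R_mono G.conn_eq[OF coset_gkm_total] B.conn_eq[OF coset_gkm_base] by (simp add: subset_iff)
  qed
  ultimately show ?thesis
    using G.gkm_graph_coset_gkm[OF coset_gkm_total] B.gkm_graph_coset_gkm[OF coset_gkm_base] graph_fibration
    unfolding gkm_fibration_def by blast
qed

section \<open>Fibers, parallel transport and the typical fiber\<close>

lemma coset_subset:
  assumes "w \<in> A"
  shows "lcoset w C\<^sub>2 \<subseteq> A"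
  using assms B.S_comp by (auto simp: B.lcoset_image)

lemma mem_lcoset_iff:
  assumes "w \<in> A" "u \<in> A"
  shows "u \<in> lcoset w C\<^sub>2 \<longleftrightarrow> lcoset u C\<^sub>2 = lcoset w C\<^sub>2"
  using assms B.lcoset_eq_iff[OF assms] by (auto simp: B.lcoset_image)

lemma reflection_cosets_fiber:
  assumes "w \<in> A"
  shows "reflection_cosets (lcoset w C\<^sub>2) C\<^sub>1 (R\<^sub>1 - R\<^sub>2)"
proof (rule fiber_cosets)
  show "lcoset w C\<^sub>2 \<subseteq> Collect orthogonal_transformation"
    using coset_subset[OF assms] G.S_orthogonal by blast
  show "u \<circ> c \<in> lcoset w C\<^sub>2" if "u \<in> lcoset w C\<^sub>2" "c \<in> C\<^sub>2" for u c
    using that assms B.C_comp by (auto simp: B.lcoset_image comp_assoc)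
qed

lemma coset_gkm_fiber:
  assumes "w \<in> A"
  shows "coset_gkm (lcoset w C\<^sub>2) C\<^sub>1 (R\<^sub>1 - R\<^sub>2) (fiber total_gkm proj (lcoset w C\<^sub>2))"
proof -
  let ?S = "lcoset w C\<^sub>2"
  \<comment> \<open>A vertex lies over \<open>?S\<close> exactly when its representatives lie in
    \<open>?S\<close>, so the fiber is itself a graph of cosets of \<open>C\<^sub>1\<close>.\<close>
  have S: "u \<in> A \<and> proj (lcoset u C\<^sub>1) = ?S \<longleftrightarrow> u \<in> ?S" for u
    using mem_lcoset_iff[OF assms] coset_subset[OF assms] proj_lcoset by auto
  have "verts (fiber total_gkm proj ?S) = (\<lambda>u. lcoset u C\<^sub>1) ` ?S"
    using S by (auto simp: fiber_def G.verts_eq[OF coset_gkm_total])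
  moreover have "edges (fiber total_gkm proj ?S) =
      {coset_edge C\<^sub>1 u \<beta> | u \<beta>. u \<in> ?S \<and> \<beta> \<in> R\<^sub>1 - R\<^sub>2}"
  proof (intro equalityI subsetI)
    fix e assume e: "e \<in> edges (fiber total_gkm proj ?S)"
    then have "e \<in> edges total_gkm" "proj (fst e) = ?S" "proj (snd e) = ?S"
      by (auto simp: fiber_def)
    moreover from this obtain u \<beta> where "u \<in> A" "\<beta> \<in> R\<^sub>1" "e = coset_edge C\<^sub>1 u \<beta>"
      by (auto simp: G.edges_eq[OF coset_gkm_total])
    ultimately have "u \<in> A" "\<beta> \<in> R\<^sub>1" "e = coset_edge C\<^sub>1 u \<beta>" "vertical proj e" "u \<in> ?S"
      using S[of u] by (simp_all add: vertical_def)
    then show "e \<in> {coset_edge C\<^sub>1 u \<beta> | u \<beta>. u \<in> ?S \<and> \<beta> \<in> R\<^sub>1 - R\<^sub>2}"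
      using vertical_iff by blast
  next
    fix e assume "e \<in> {coset_edge C\<^sub>1 u \<beta> | u \<beta>. u \<in> ?S \<and> \<beta> \<in> R\<^sub>1 - R\<^sub>2}"
    then obtain u \<beta> where u: "u \<in> ?S" "\<beta> \<in> R\<^sub>1" "\<beta> \<notin> R\<^sub>2" "e = coset_edge C\<^sub>1 u \<beta>"
      by blast
    then have "u \<in> A" "proj (fst e) = ?S" using S by auto
    moreover from this u have "e \<in> edges total_gkm" "vertical proj e"
      using G.edge_in_edges[OF coset_gkm_total] vertical_iff by auto
    ultimately show "e \<in> edges (fiber total_gkm proj ?S)"
      by (cases e) (auto simp: fiber_def vertical_def)
  qed
  ultimately show ?thesis
    unfolding coset_gkm_def
    using coset_subset[OF assms] G.axial_eq[OF coset_gkm_total] G.conn_eq[OF coset_gkm_total]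
    by (auto simp: fiber_def subset_iff)
qed

text \<open>Parallel transport along the edge labelled \<open>w \<beta>\<close> is left multiplication by the reflection
  \<open>s\<^bsub>w \<beta>\<^esub>\<close>, which does not depend on the point of the fiber.\<close>

lemma transport_eq:
  assumes w: "w \<in> A" and \<beta>: "\<beta> \<in> R\<^sub>2" and u: "u \<in> lcoset w C\<^sub>2"
  obtains \<gamma> where "\<gamma> \<in> R\<^sub>2" "u \<circ> root_refl \<gamma> = root_refl (w \<beta>) \<circ> u"
    "lift total_gkm base_gkm proj (coset_edge C\<^sub>2 w \<beta>) (lcoset u C\<^sub>1) = coset_edge C\<^sub>1 u \<gamma>"
proof -
  have uA: "u \<in> A" using u coset_subset w by blast
  have "lcoset u C\<^sub>2 = lcoset w C\<^sub>2" using mem_lcoset_iff u uA w by blast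
  then obtain c where c: "c \<in> C\<^sub>2" "w = u \<circ> c" "coset_edge C\<^sub>2 w \<beta> = coset_edge C\<^sub>2 u (c \<beta>)"
    using B.same_vertexE[OF uA w] \<beta> by metis
  have "c \<beta> \<in> R\<^sub>2" using B.C_R c(1) \<beta> by blast
  moreover have "u \<circ> root_refl (c \<beta>) = root_refl (w \<beta>) \<circ> u"
    \<comment> \<open>Here \<open>u (c \<beta>) = w \<beta>\<close> because
      \<open>w = u \<circ> c\<close>; the reflection on the left is thus the same for every
      \<open>u\<close> in the fiber.\<close>
    using orthogonal_transformation_root_refl_conj[OF G.S_orthogonal[OF uA]] c(2) by simp
  moreover have "lift total_gkm base_gkm proj (coset_edge C\<^sub>2 w \<beta>) (lcoset u C\<^sub>1) = coset_edge C\<^sub>1 u (c \<beta>)"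
    unfolding c(3) using uA calculation(1) by (rule lift_eq)
  ultimately show thesis using that by blast
qed

lemma gkm_fiber_bundle: "gkm_fiber_bundle total_gkm base_gkm proj"
proof -
  have "graph_morphism (fiber total_gkm proj p) (fiber total_gkm proj q) (transport total_gkm base_gkm proj p q) \<and>
      (\<forall>(p\<^sub>1, p\<^sub>2)\<in>edges (fiber total_gkm proj p).
         conn total_gkm (lift total_gkm base_gkm proj (p, q) p\<^sub>1) (p\<^sub>1, p\<^sub>2) =
         (transport total_gkm base_gkm proj p q p\<^sub>1, transport total_gkm base_gkm proj p q p\<^sub>2)) \<and>
      (\<exists>\<Psi>. gkm_iso (fiber total_gkm proj p) (fiber total_gkm proj q) (transport total_gkm base_gkm proj p q) \<Psi>)"
    if pq: "(p, q) \<in> edges base_gkm" for p q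
  proof -
    obtain w \<beta> where w: "w \<in> A" "\<beta> \<in> R\<^sub>2" and e: "(p, q) = coset_edge C\<^sub>2 w \<beta>"
      using pq by (auto simp: B.edges_eq[OF coset_gkm_base])
    let ?g = "root_refl (w \<beta>)" and ?v = "w \<circ> root_refl \<beta>" and ?T = "transport total_gkm base_gkm proj p q"
    have p: "p = lcoset w C\<^sub>2" and q: "q = lcoset ?v C\<^sub>2"
      using e by (auto simp: coset_edge_def)
    have v: "?v \<in> A" using B.S_refl w by blast
    have vg: "?v = ?g \<circ> w"
      using orthogonal_transformation_root_refl_conj G.S_orthogonal w(1) by blast
    interpret P: reflection_cosets p C\<^sub>1 "R\<^sub>1 - R\<^sub>2"
      unfolding p by (rule reflection_cosets_fiber[OF w(1)])
    interpret Q: reflection_cosets q C\<^sub>1 "R\<^sub>1 - R\<^sub>2"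
      unfolding q by (rule reflection_cosets_fiber[OF v])
    have P: "coset_gkm p C\<^sub>1 (R\<^sub>1 - R\<^sub>2) (fiber total_gkm proj p)"
      unfolding p by (rule coset_gkm_fiber[OF w(1)])
    have Q: "coset_gkm q C\<^sub>1 (R\<^sub>1 - R\<^sub>2) (fiber total_gkm proj q)"
      unfolding q by (rule coset_gkm_fiber[OF v])
    have transport: "?T (lcoset u C\<^sub>1) = lcoset (?g \<circ> u) C\<^sub>1" if u: "u \<in> p" for u
    proof -
      obtain \<gamma> where "u \<circ> root_refl \<gamma> = ?g \<circ> u"
          "lift total_gkm base_gkm proj (p, q) (lcoset u C\<^sub>1) = coset_edge C\<^sub>1 u \<gamma>"
        using transport_eq[OF w u[unfolded p]] unfolding e by blast
      then show ?thesis by (simp add: transport_def)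
    qed
    \<comment> \<open>By \<open>vg\<close> the representative of \<open>q\<close> is
      \<open>?g \<circ> w\<close>, so \<open>?g\<close> carries one fiber's coset onto the
      other.\<close>
    have "q = (\<circ>) ?g ` p"
      unfolding p q B.lcoset_image[OF w(1)] B.lcoset_image[OF v] unfolding vg
      by (simp add: image_image comp_assoc)
    then have iso: "gkm_iso (fiber total_gkm proj p) (fiber total_gkm proj q) ?T ?g"
      using gkm_iso_left_mult[OF P.reflection_cosets_axioms Q.reflection_cosets_axioms P Q
          orthogonal_transformation_root_refl] transport by blast
    then have "graph_iso (fiber total_gkm proj p) (fiber total_gkm proj q) ?T"
      by (simp add: gkm_iso_def)
    moreover have "edges (fiber total_gkm proj p) \<subseteq> verts (fiber total_gkm proj p) \<times> verts (fiber total_gkm proj p)"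
      using P.regular_graph_coset_gkm[OF P] by (simp add: regular_graph_def)
    ultimately have "graph_morphism (fiber total_gkm proj p) (fiber total_gkm proj q) ?T"
      by (auto simp: graph_iso_def graph_morphism_def bij_betw_def)
    moreover have "conn total_gkm (lift total_gkm base_gkm proj (p, q) p\<^sub>1) (p\<^sub>1, p\<^sub>2) = (?T p\<^sub>1, ?T p\<^sub>2)"
      if edge: "(p\<^sub>1, p\<^sub>2) \<in> edges (fiber total_gkm proj p)" for p\<^sub>1 p\<^sub>2
    proof -
      obtain u \<delta> where u: "u \<in> p" "\<delta> \<in> R\<^sub>1 - R\<^sub>2" "(p\<^sub>1, p\<^sub>2) = coset_edge C\<^sub>1 u \<delta>"
        using edge unfolding P.edges_eq[OF P] by blast
      obtain \<gamma> where \<gamma>: "\<gamma> \<in> R\<^sub>2" "u \<circ> root_refl \<gamma> = ?g \<circ> u"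
          "lift total_gkm base_gkm proj (p, q) p\<^sub>1 = coset_edge C\<^sub>1 u \<gamma>"
        using transport_eq[OF w u(1)[unfolded p]] u(3) unfolding e by (metis fst_coset_edge fst_conv)
      \<comment> \<open>The connection keeps \<delta> and changes \<open>u\<close> to
        \<open>u \<circ> root_refl \<gamma>\<close>, which is \<open>?g \<circ> u\<close>, the
        representative produced by transport.\<close>
      have "conn total_gkm (coset_edge C\<^sub>1 u \<gamma>) (coset_edge C\<^sub>1 u \<delta>) = coset_edge C\<^sub>1 (?g \<circ> u) \<delta>"
        using G.conn_eq[OF coset_gkm_total, of u \<gamma> \<delta>] u \<gamma> R_mono coset_subset[OF w(1)] p by auto
      moreover have "(?T p\<^sub>1, ?T p\<^sub>2) = coset_edge C\<^sub>1 (?g \<circ> u) \<delta>"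
        using u(3) transport[OF u(1)] transport[OF P.S_refl[OF u(1,2)]]
        by (simp add: coset_edge_def comp_assoc)
      ultimately show ?thesis using u(3) \<gamma>(3) by simp
    qed
    ultimately show ?thesis using iso by blast
  qed
  then show ?thesis
    unfolding gkm_fiber_bundle_def using gkm_fibration by blast
qed

text \<open>The fiber over the coset of \<open>w\<close> is translated back to
  \<open>C\<^sub>2\<close> by the inverse of \<open>w\<close>, again an isometry.\<close>

lemma fiber_isomorphic:
  assumes "p \<in> verts base_gkm"
  shows "gkm_isomorphic (fiber total_gkm proj p) (quotient_gkm C\<^sub>2 C\<^sub>1 (R\<^sub>1 - R\<^sub>2))"
proof -
  obtain w where w: "w \<in> A" "p = lcoset w C\<^sub>2"
    using assms by (auto simp: B.verts_eq[OF coset_gkm_base])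
  let ?g = "inv_into UNIV w"
  \<comment> \<open>Translating cosets as sets requires no choice of representative.\<close>
  let ?\<Phi> = "\<lambda>P. (\<circ>) ?g ` P"
  have g: "orthogonal_transformation ?g"
    using orthogonal_transformation_inv G.S_orthogonal w(1) by blast
  have gw: "?g \<circ> (w \<circ> c) = c" for c
    using G.S_inj[OF w(1)] by (simp add: fun_eq_iff)
  interpret P: reflection_cosets p C\<^sub>1 "R\<^sub>1 - R\<^sub>2"
    unfolding w(2) by (rule reflection_cosets_fiber[OF w(1)])
  interpret F: reflection_cosets C\<^sub>2 C\<^sub>1 "R\<^sub>1 - R\<^sub>2"
    using B.C_orthogonal B.C_comp by (intro fiber_cosets) auto
  have eq: "C\<^sub>2 = (\<circ>) ?g ` p"
    unfolding w(2) B.lcoset_image[OF w(1)] by (simp add: image_image gw)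
  have "?\<Phi> (lcoset u C\<^sub>1) = lcoset (?g \<circ> u) C\<^sub>1" if "u \<in> p" for u
  proof -
    have "?g \<circ> u \<in> C\<^sub>2" using that eq by blast
    then show ?thesis
      using that by (simp add: P.lcoset_image F.lcoset_image image_image comp_assoc)
  qed
  then have "gkm_iso (fiber total_gkm proj p) (quotient_gkm C\<^sub>2 C\<^sub>1 (R\<^sub>1 - R\<^sub>2)) ?\<Phi> ?g"
    using gkm_iso_left_mult[OF P.reflection_cosets_axioms F.reflection_cosets_axioms
        coset_gkm_fiber[OF w(1), folded w(2)] F.coset_gkm_quotient g eq] by blast
  then show ?thesis
    unfolding gkm_isomorphic_def by blast
qed

end


section \<open>The fiber bundle of a pair of parabolic subgroups\<close>

context based_root_system
begin

lemma reflection_cosets_parabolic: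
  assumes "\<Sigma> \<subseteq> \<Delta>\<^sub>0"
  shows "reflection_cosets (refl_group \<Delta>) (refl_group \<Sigma>) (pos - roots_spanned \<Delta> \<Delta>\<^sub>0 \<Sigma>)"
proof
  have sub: "refl_group \<Sigma> \<subseteq> refl_group \<Delta>"
    using assms simple_root by (intro refl_group_mono) auto
  fix w c :: "'a \<Rightarrow> 'a" and \<beta> \<gamma> :: 'a and t
  show "w \<in> refl_group \<Delta> \<Longrightarrow> c \<in> refl_group \<Sigma> \<Longrightarrow> w \<circ> c \<in> refl_group \<Delta>"
    using sub comp_in_refl_group by blast
  show "w \<in> refl_group \<Delta> \<Longrightarrow> \<beta> \<in> pos - roots_spanned \<Delta> \<Delta>\<^sub>0 \<Sigma> \<Longrightarrow> w \<circ> root_refl \<beta> \<in> refl_group \<Delta>"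
    using comp_in_refl_group root_refl_in_refl_group pos_root by blast
  \<comment> \<open>Simple roots span the whole space, so the permutation lemma with
    \<open>\<Sigma>' = \<Delta>\<^sub>0\<close> covers all positive roots outside the parabolic
    part.\<close>
  have "roots_spanned \<Delta> \<Delta>\<^sub>0 \<Delta>\<^sub>0 = pos"
    by (simp add: roots_spanned_def span_simple)
  then show "c \<in> refl_group \<Sigma> \<Longrightarrow> \<beta> \<in> pos - roots_spanned \<Delta> \<Delta>\<^sub>0 \<Sigma> \<Longrightarrow>
      c \<beta> \<in> pos - roots_spanned \<Delta> \<Delta>\<^sub>0 \<Sigma>"
    using refl_group_permutes_complement[OF assms assms] by simp
  show "finite (pos - roots_spanned \<Delta> \<Delta>\<^sub>0 \<Sigma>)"
    using finite_roots by (rule finite_subset[rotated]) (auto simp: pos_root)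
  show "\<beta> \<in> pos - roots_spanned \<Delta> \<Delta>\<^sub>0 \<Sigma> \<Longrightarrow> \<exists>x. x \<bullet> \<beta> \<noteq> 0 \<and> (\<forall>c\<in>refl_group \<Sigma>. c x = x)"
    by (rule exists_refl_group_fixed) (auto simp: roots_spanned_def)
qed (use refl_group_orthogonal id_in_refl_group comp_in_refl_group refl_group_inverse
    pos_parallel_eq in blast)+

text \<open>A positive root that is vertical lies in the span of \<open>\<Sigma>\<^sub>2\<close>, so
  \<open>refl_in_refl_group\<close> supplies the condition \<open>fiber_refl\<close>.\<close>

lemma reflection_coset_tower_parabolic:
  assumes "\<Sigma>\<^sub>1 \<subseteq> \<Sigma>\<^sub>2" "\<Sigma>\<^sub>2 \<subseteq> \<Delta>\<^sub>0"
  shows "reflection_coset_tower (refl_group \<Delta>) (refl_group \<Sigma>\<^sub>1) (refl_group \<Sigma>\<^sub>2)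
    (pos - roots_spanned \<Delta> \<Delta>\<^sub>0 \<Sigma>\<^sub>1) (pos - roots_spanned \<Delta> \<Delta>\<^sub>0 \<Sigma>\<^sub>2)"
proof -
  have "roots_spanned \<Delta> \<Delta>\<^sub>0 \<Sigma>\<^sub>1 \<subseteq> roots_spanned \<Delta> \<Delta>\<^sub>0 \<Sigma>\<^sub>2"
    using span_mono[OF assms(1)] by (auto simp: roots_spanned_def)
  then show ?thesis
    using assms reflection_cosets_parabolic[of \<Sigma>\<^sub>1] reflection_cosets_parabolic[of \<Sigma>\<^sub>2]
      refl_group_mono[OF assms(1)] refl_in_refl_group[OF assms(2)]
    unfolding reflection_coset_tower_def reflection_coset_tower_axioms_def by blast
qed

end

theorem mainTheorem4:
  fixes \<Delta> \<Delta>\<^sub>0 \<Sigma>\<^sub>1 \<Sigma>\<^sub>2 :: "'a::euclidean_space set"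
  assumes "root_system \<Delta>"
    and "simple_roots \<Delta> \<Delta>\<^sub>0"
    and "\<Sigma>\<^sub>1 \<subset> \<Sigma>\<^sub>2"
    and "\<Sigma>\<^sub>2 \<subset> \<Delta>\<^sub>0"
  defines "W \<equiv> refl_group \<Delta>"
    and "W\<^sub>1 \<equiv> refl_group \<Sigma>\<^sub>1"
    and "W\<^sub>2 \<equiv> refl_group \<Sigma>\<^sub>2"
  defines "G \<equiv> quotient_gkm W W\<^sub>1 (positive_roots \<Delta> \<Delta>\<^sub>0 - roots_spanned \<Delta> \<Delta>\<^sub>0 \<Sigma>\<^sub>1)"
    and "B \<equiv> quotient_gkm W W\<^sub>2 (positive_roots \<Delta> \<Delta>\<^sub>0 - roots_spanned \<Delta> \<Delta>\<^sub>0 \<Sigma>\<^sub>2)"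
    and "F \<equiv> quotient_gkm W\<^sub>2 W\<^sub>1 (roots_spanned \<Delta> \<Delta>\<^sub>0 \<Sigma>\<^sub>2 - roots_spanned \<Delta> \<Delta>\<^sub>0 \<Sigma>\<^sub>1)"
    and "\<pi> \<equiv> coset_proj W W\<^sub>1 W\<^sub>2"
  shows "gkm_fiber_bundle G B \<pi> \<and> (\<forall>p\<in>verts B. gkm_isomorphic (fiber G \<pi> p) F)"
proof -
  interpret based_root_system \<Delta> \<Delta>\<^sub>0
    using assms(1,2) by unfold_locales
  interpret reflection_coset_tower W W\<^sub>1 W\<^sub>2 "pos - roots_spanned \<Delta> \<Delta>\<^sub>0 \<Sigma>\<^sub>1"
    "pos - roots_spanned \<Delta> \<Delta>\<^sub>0 \<Sigma>\<^sub>2"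
    unfolding W_def W\<^sub>1_def W\<^sub>2_def using assms(3,4) by (intro reflection_coset_tower_parabolic) auto
  \<comment> \<open>The roots of the graph \<open>F\<close> are exactly the vertical roots of the
    tower.\<close>
  have "roots_spanned \<Delta> \<Delta>\<^sub>0 \<Sigma>\<^sub>2 - roots_spanned \<Delta> \<Delta>\<^sub>0 \<Sigma>\<^sub>1 =
      (pos - roots_spanned \<Delta> \<Delta>\<^sub>0 \<Sigma>\<^sub>1) - (pos - roots_spanned \<Delta> \<Delta>\<^sub>0 \<Sigma>\<^sub>2)"
    by (auto simp: roots_spanned_def)
  then show ?thesis
    unfolding G_def B_def F_def \<pi>_def using gkm_fiber_bundle fiber_isomorphic by simp
qed

end
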